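(* Let $\ell,m\ge 1$ be integers and let $(w_{jk})_{1\le j\le \ell,\,1\le k\le m}$ be nonnegative integers such that every row sum and every column sum is strictly positive; let $n:=\sum_{j,k}w_{jk}$. Let $\mathcal{P}$, $\Theta$, $f$, $\Psi^{\rm row}$, $\Psi^{\rm col}$ and the step size $t_*(\boldsymbol\theta)$ (for a given proposal function $\Psi$) be as defined in the context, and let $\hat{\boldsymbol\theta}$ be the unique minimizer of $f$ over $\Theta$. Let $\boldsymbol\theta^{(0)}\in\Theta$ be arbitrary, and for $s=0,1,2,\dots$ let $$\boldsymbol\theta^{(s+1)}:=\bigl(1-t_*^{(s)}\bigr)\boldsymbol\theta^{(s)}+t_*^{(s)}\,\Psi^{(s)}(\boldsymbol\theta^{(s)}),$$ where for each $s$ the proposal function $\Psi^{(s)}\in\{\Psi^{\rm row},\Psi^{\rm col}\}$ is chosen arbitrarily and $t_*^{(s)}:=t_*(\boldsymbol\theta^{(s)})\in[0,1]$ is the step size computed with $\Psi=\Psi^{(s)}$. Then $$\lim_{s\to\infty}\boldsymbol\theta^{(s)}=\hat{\boldsymbol\theta}.$$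
   Context: The $w_{jk}$ are the counts $w_{jk}=\#\{i:(X_i,Y_i)=(x_j,y_k)\}$ of $n$ observations, where $x_1<\dots<x_\ell$ and $y_1<\dots<y_m$ are the distinct observed values. **Index set.** $\mathcal{P}$ is the set of all $(j,k)\in\{1,\dots,\ell\}\times\{1,\dots,m\}$ such that there exist $1\le j_1\le j\le j_2\le\ell$ and $1\le k_1\le k\le k_2\le m$ with $w_{j_1k_2},w_{j_2k_1}>0$. Set $m_j:=\min\{k: w_{j'k}>0\text{ for some }j'\ge j\}$, $M_j:=\max\{k:w_{j'k}>0\text{ for some }j'\le j\}$, $\ell_k:=\min\{j:w_{jk'}>0\text{ for some }k'\ge k\}$, $L_k:=\max\{j:w_{jk'}>0\text{ for some }k'\le k\}$. Then $(j,k)\in\mathcal{P}$ iff $m_j\le k\le M_j$ iff $\ell_k\le j\le L_k$. **Optimization problem.** $\Theta$ is the closed convex cone of all $\boldsymbol\theta\in\mathbb{R}^{\mathcal{P}}$ with $\theta_{j-1,k-1}+\theta_{j,k}-\theta_{j-1,k}-\theta_{j,k-1}\ge0$ for all $1<j\le\ell$, $1<k\le m$ such that $(j-1,k),(j,k-1)\in\mathcal{P}$ (all four index pairs then lie in $\mathcal{P}$). The target function is $f(\boldsymbol\theta):=\sum_{(j,k)\in\mathcal{P}}(-w_{jk}\theta_{jk}+n\exp(\theta_{jk}))$. It has a unique minimizer $\hat{\boldsymbol\theta}$ over $\Theta$. **Proposal $\Psi^{\rm row}$.** Let $T:\mathbb{R}^{\mathcal{P}}\to\mathbb{R}^{\mathcal{P}}$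 be the linear bijection with $T_{jm_j}(\boldsymbol\theta)=\theta_{jm_j}$ and $T_{jk}(\boldsymbol\theta)=\theta_{jk}-\theta_{j,k-1}$ for $m_j<k\le M_j$. Put $\tilde v_{jk}(\boldsymbol\theta):=n\sum_{k'=k}^{M_j}\exp(\theta_{jk'})$ and $\tilde\gamma_{jk}(\boldsymbol\theta):=T_{jk}(\boldsymbol\theta)+\tilde v_{jk}(\boldsymbol\theta)^{-1}\sum_{k'=k}^{M_j}w_{jk'}-1$. Then $$\Psi^{\rm row}(\boldsymbol\theta):=T^{-1}\Bigl(\operatorname*{arg\,min}_{\tilde{\boldsymbol x}\in T(\Theta)}\sum_{(j,k)\in\mathcal{P}}\tilde v_{jk}(\boldsymbol\theta)\bigl(\tilde x_{jk}-\tilde\gamma_{jk}(\boldsymbol\theta)\bigr)^2\Bigr).$$ **Proposal $\Psi^{\rm col}$.** This is the same construction with the roles of rows and columns exchanged: $T$ is replaced with $T^{\rm col}$, where $T^{\rm col}_{\ell_kk}(\boldsymbol\theta)=\theta_{\ell_kk}$ and $T^{\rm col}_{jk}(\boldsymbol\theta)=\theta_{jk}-\theta_{j-1,k}$ for $\ell_k<j\le L_k$; $\tilde v_{jk}(\boldsymbol\theta)$ with $n\sum_{j'=j}^{L_k}\exp(\theta_{j'k})$; and $\sum_{k'=k}^{M_j}w_{jk'}$ with $\sum_{j'=j}^{L_k}w_{j'k}$. **Step size.** Given $\Psi\in\{\Psi^{\rm row},\Psi^{\rm col}\}$ and $\boldsymbol\theta\in\Theta\setminus\{\hat{\boldsymbol\theta}\}$,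 let $\rho_{\boldsymbol\theta}(t):=f(\boldsymbol\theta)-f((1-t)\boldsymbol\theta+t\Psi(\boldsymbol\theta))$. Let $t_o:=2^{-n_o}$ with $n_o$ the smallest nonnegative integer such that $\rho_{\boldsymbol\theta}(2^{-n_o})\ge0$, let $c_o:=t_o^{-1}\bigl(\rho_{\boldsymbol\theta}'(0)-t_o^{-1}\rho_{\boldsymbol\theta}(t_o)\bigr)$ (which is $>0$), and $$t_*(\boldsymbol\theta):=\min\bigl(t_o,\,2^{-1}\rho_{\boldsymbol\theta}'(0)/c_o\bigr).$$ If $\boldsymbol\theta=\hat{\boldsymbol\theta}$, then $\Psi(\boldsymbol\theta)=\boldsymbol\theta$ and $t_*(\boldsymbol\theta)\in[0,1]$ is arbitrary (the iteration then stays at $\hat{\boldsymbol\theta}$). *)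

theory Defs
  imports "HOL-Analysis.Analysis"
begin

text \<open>
  The space of real vectors indexed by the index set \<open>\<P>\<close> is represented by the functions on
  pairs of natural numbers (1-based indices) that vanish outside of \<open>\<P>\<close>. The product
  topology on functions induces the Euclidean topology there, as \<open>\<P>\<close> is finite. Only the values
  \<open>w j k\<close> with \<open>j \<in> {1..l}\<close> and \<open>k \<in> {1..m}\<close> are relevant.
\<close>

type_synonym vec = "nat \<times> nat \<Rightarrow> real"

definition segment_point :: "vec \<Rightarrow> vec \<Rightarrow> real \<Rightarrow> vec" where
  "segment_point \<theta> \<psi> t = (\<lambda>p. (1 - t) * \<theta> p + t * \<psi> p)"

locale lr_weights =
  fixes l m :: nat and w :: "nat \<Rightarrow> nat \<Rightarrow> nat"
begin

definition n_obs :: nat where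
  "n_obs = (\<Sum>j=1..l. \<Sum>k=1..m. w j k)"

definition \<P> :: "(nat \<times> nat) set" where
  "\<P> = {(j, k) \<in> {1..l} \<times> {1..m}. \<exists>j1 j2 k1 k2.
      1 \<le> j1 \<and> j1 \<le> j \<and> j \<le> j2 \<and> j2 \<le> l \<and>
      1 \<le> k1 \<and> k1 \<le> k \<and> k \<le> k2 \<and> k2 \<le> m \<and>
      w j1 k2 > 0 \<and> w j2 k1 > 0}"

text \<open>The four bounds are \<open>m\<^sub>j\<close>, \<open>M\<^sub>j\<close>, \<open>l\<^sub>k\<close> and \<open>L\<^sub>k\<close>, respectively.\<close>

definition row_lo :: "nat \<Rightarrow> nat" where
  "row_lo j = Min {k \<in> {1..m}. \<exists>j'\<in>{j..l}. w j' k > 0}"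

definition row_hi :: "nat \<Rightarrow> nat" where
  "row_hi j = Max {k \<in> {1..m}. \<exists>j'\<in>{1..j}. w j' k > 0}"

definition col_lo :: "nat \<Rightarrow> nat" where
  "col_lo k = Min {j \<in> {1..l}. \<exists>k'\<in>{k..m}. w j k' > 0}"

definition col_hi :: "nat \<Rightarrow> nat" where
  "col_hi k = Max {j \<in> {1..l}. \<exists>k'\<in>{1..k}. w j k' > 0}"

definition vecs :: "vec set" where
  "vecs = {\<theta>. \<forall>p. p \<notin> \<P> \<longrightarrow> \<theta> p = 0}"

definition \<Theta> :: "vec set" where
  "\<Theta> = {\<theta> \<in> vecs. \<forall>j k. 1 < j \<and> j \<le> l \<and> 1 < k \<and> k \<le> m \<and>
      (j - 1, k) \<in> \<P> \<and> (j, k - 1) \<in> \<P> \<longrightarrow>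
      \<theta> (j - 1, k - 1) + \<theta> (j, k) - \<theta> (j - 1, k) - \<theta> (j, k - 1) \<ge> 0}"

definition f :: "vec \<Rightarrow> real" where
  "f \<theta> = (\<Sum>(j, k)\<in>\<P>. - real (w j k) * \<theta> (j, k) + real n_obs * exp (\<theta> (j, k)))"

definition theta_hat :: vec where
  "theta_hat = arg_min_on f \<Theta>"

text \<open>
  The construction shared by the row and the column proposal: \<open>T\<close> is the linear bijection of
  \<^term>\<open>vecs\<close>, \<open>v\<close> are the weights \<open>v\<^sub>j\<^sub>k(\<theta>)\<close> (depending on \<open>\<theta>\<close>), and \<open>W\<close> are the partial sums
  of the observed counts.
\<close>

definition proposal ::
  "(vec \<Rightarrow> vec) \<Rightarrow> (vec \<Rightarrow> nat \<times> nat \<Rightarrow> real) \<Rightarrow> (nat \<times> nat \<Rightarrow> real) \<Rightarrow> vec \<Rightarrow> vec" where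
  "proposal T v W \<theta> =
     (let \<gamma> = (\<lambda>p. T \<theta> p + inverse (v \<theta> p) * W p - 1)
      in the_inv_into vecs T
           (arg_min_on (\<lambda>x. \<Sum>p\<in>\<P>. v \<theta> p * (x p - \<gamma> p)\<^sup>2) (T ` \<Theta>)))"

definition T_row :: "vec \<Rightarrow> vec" where
  "T_row \<theta> = (\<lambda>(j, k).
     if (j, k) \<notin> \<P> then 0
     else if k = row_lo j then \<theta> (j, k)
     else \<theta> (j, k) - \<theta> (j, k - 1))"

definition v_row :: "vec \<Rightarrow> nat \<times> nat \<Rightarrow> real" where
  "v_row \<theta> = (\<lambda>(j, k). real n_obs * (\<Sum>k'=k..row_hi j. exp (\<theta> (j, k'))))"

definition W_row :: "nat \<times> nat \<Rightarrow> real" where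
  "W_row = (\<lambda>(j, k). \<Sum>k'=k..row_hi j. real (w j k'))"

definition Psi_row :: "vec \<Rightarrow> vec" where
  "Psi_row = proposal T_row v_row W_row"

definition T_col :: "vec \<Rightarrow> vec" where
  "T_col \<theta> = (\<lambda>(j, k).
     if (j, k) \<notin> \<P> then 0
     else if j = col_lo k then \<theta> (j, k)
     else \<theta> (j, k) - \<theta> (j - 1, k))"

definition v_col :: "vec \<Rightarrow> nat \<times> nat \<Rightarrow> real" where
  "v_col \<theta> = (\<lambda>(j, k). real n_obs * (\<Sum>j'=j..col_hi k. exp (\<theta> (j', k))))"

definition W_col :: "nat \<times> nat \<Rightarrow> real" where
  "W_col = (\<lambda>(j, k). \<Sum>j'=j..col_hi k. real (w j' k))"

definition Psi_col :: "vec \<Rightarrow> vec" where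
  "Psi_col = proposal T_col v_col W_col"

definition \<rho> :: "(vec \<Rightarrow> vec) \<Rightarrow> vec \<Rightarrow> real \<Rightarrow> real" where
  "\<rho> \<Psi> \<theta> t = f \<theta> - f (segment_point \<theta> (\<Psi> \<theta>) t)"

definition t_o :: "(vec \<Rightarrow> vec) \<Rightarrow> vec \<Rightarrow> real" where
  "t_o \<Psi> \<theta> = (1 / 2) ^ (LEAST N. \<rho> \<Psi> \<theta> ((1 / 2) ^ N) \<ge> 0)"

definition c_o :: "(vec \<Rightarrow> vec) \<Rightarrow> vec \<Rightarrow> real" where
  "c_o \<Psi> \<theta> = inverse (t_o \<Psi> \<theta>) *
     (deriv (\<rho> \<Psi> \<theta>) 0 - inverse (t_o \<Psi> \<theta>) * \<rho> \<Psi> \<theta> (t_o \<Psi> \<theta>))"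

definition t_star :: "(vec \<Rightarrow> vec) \<Rightarrow> vec \<Rightarrow> real" where
  "t_star \<Psi> \<theta> = min (t_o \<Psi> \<theta>) (deriv (\<rho> \<Psi> \<theta>) 0 / 2 / c_o \<Psi> \<theta>)"

text \<open>At the minimizer, the step size may be chosen arbitrarily in the unit interval.\<close>

definition step_sizes :: "(vec \<Rightarrow> vec) \<Rightarrow> vec \<Rightarrow> real set" where
  "step_sizes \<Psi> \<theta> = (if \<theta> = theta_hat then {0..1} else {t_star \<Psi> \<theta>})"

end

end

theory Submission imports Defs
begin

text \<open>
  On a sublevel set of \<open>f\<close> within \<open>\<Theta>\<close> all coordinates are bounded, so all constants below are uniform
  there. Both proposals minimize over \<open>\<Theta>\<close> the quadratic model of \<open>f\<close> at \<open>\<theta>\<close> that has the exact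
  gradient and the curvature \<open>\<Sum>\<^sub>p v\<^sub>p (T d)\<^sub>p\<^sup>2\<close>. Let \<open>\<delta> = \<Psi> \<theta> - \<theta>\<close>. The variational inequality of this
  problem, tested with \<open>\<theta>\<close>, gives \<open>\<rho>'(0) \<ge> c \<bar>\<delta>\<bar>\<^sup>2\<close>; hence \<open>t\<^sub>o\<close> is bounded away from zero and each step
  decreases \<open>f\<close> by at least \<open>\<eta> \<bar>\<delta>\<bar>\<^sup>2\<close>, so that \<open>\<delta> \<longlonglongrightarrow> 0\<close> along the iteration. Tested with the minimizer,
  the same inequality gives \<open>f \<theta> - f theta_hat \<le> C \<bar>\<delta>\<bar>\<close>, and strong convexity of \<open>f\<close> on bounded sets
  turns this into convergence of \<open>\<theta>\<close>.
\<close>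

section \<open>Scalar inequalities and minimization in product spaces\<close>

text \<open>Lagrange form of the remainder: the intermediate point is \<open>x + t\<close> with
  \<open>\<bar>t\<bar> \<le> \<bar>y - x\<bar> \<le> 2 * R\<close>, so it lies within
  \<open>3 * R\<close> of zero. This is the origin of every factor \<open>exp (3 * R)\<close> and
  \<open>exp (- (3 * R))\<close> below.\<close>

lemma exp_taylor2:
  fixes x y R :: real
  assumes "\<bar>x\<bar> \<le> R" "\<bar>y\<bar> \<le> R"
  shows "exp (- (3 * R)) / 2 * (y - x)\<^sup>2 \<le> exp y - exp x - exp x * (y - x)"
    and "exp y - exp x - exp x * (y - x) \<le> exp (3 * R) / 2 * (y - x)\<^sup>2"
proof -
  obtain t where t: "\<bar>t\<bar> \<le> \<bar>y - x\<bar>"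
    "exp (y - x) = (\<Sum>m<2. (y - x) ^ m / fact m) + (exp t / fact 2) * (y - x) ^ 2"
    using Maclaurin_exp_le by blast
  have "exp y = exp x * exp (y - x)" by (simp flip: exp_add)
  then have e: "exp y - exp x - exp x * (y - x) = exp (x + t) / 2 * (y - x)\<^sup>2"
    by (simp add: t(2) numeral_2_eq_2 exp_add algebra_simps)
  have "- (3 * R) \<le> x + t" "x + t \<le> 3 * R" using assms t(1) by auto
  then have "exp (- (3 * R)) \<le> exp (x + t)" "exp (x + t) \<le> exp (3 * R)" by simp_all
  then show "exp (- (3 * R)) / 2 * (y - x)\<^sup>2 \<le> exp y - exp x - exp x * (y - x)"
    "exp y - exp x - exp x * (y - x) \<le> exp (3 * R) / 2 * (y - x)\<^sup>2"
    unfolding e by (intro mult_right_mono; simp)+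
qed

text \<open>If \<open>a\<close> were negative, the explicit \<open>\<epsilon>\<close> of the proof
  would make \<open>b * \<epsilon>\<close> at most half of \<open>- a\<close>. The lemma turns
  minimality along a segment into a first-order condition.\<close>

lemma nonneg_of_quadratic_nonneg:
  fixes a b :: real
  assumes "\<And>\<epsilon>. 0 < \<epsilon> \<Longrightarrow> \<epsilon> \<le> 1 \<Longrightarrow> 0 \<le> a * \<epsilon> + b * \<epsilon>\<^sup>2"
  shows "0 \<le> a"
proof (rule ccontr)
  assume "\<not> 0 \<le> a"
  define \<epsilon> where "\<epsilon> = min 1 (- a / (2 * (\<bar>b\<bar> + 1)))"
  have e: "0 < \<epsilon>" "\<epsilon> \<le> 1" using \<open>\<not> 0 \<le> a\<close> by (auto simp: \<epsilon>_def divide_neg_pos)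
  have "\<epsilon> \<le> - a / (2 * (\<bar>b\<bar> + 1))" by (simp add: \<epsilon>_def)
  then have "2 * ((\<bar>b\<bar> + 1) * \<epsilon>) \<le> - a"
    by (subst (asm) pos_le_divide_eq) (auto simp: algebra_simps)
  moreover have "b * \<epsilon> \<le> (\<bar>b\<bar> + 1) * \<epsilon>" using e by (intro mult_right_mono) auto
  ultimately have "a + b * \<epsilon> \<le> a / 2" by argo
  then have "a + b * \<epsilon> < 0" using \<open>\<not> 0 \<le> a\<close> by simp
  then have "(a + b * \<epsilon>) * \<epsilon> < 0" using e by (simp add: mult_neg_pos)
  then show False using assms[OF e] by (simp add: algebra_simps power2_eq_square)
qed

section \<open>Existence of minimizers and convergence in the product topology\<close>

text \<open>\<open>arg_min_on\<close> is a Hilbert choice, so its value is known to minimize only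
  after some minimizer \<open>x\<close> has been exhibited.\<close>

lemma arg_min_on_minimizes:
  fixes g :: "'a \<Rightarrow> real"
  assumes "x \<in> S" "\<And>y. y \<in> S \<Longrightarrow> g x \<le> g y"
  shows "arg_min_on g S \<in> S" "\<And>y. y \<in> S \<Longrightarrow> g (arg_min_on g S) \<le> g y"
proof -
  have "is_arg_min g (\<lambda>x. x \<in> S) x" using assms by (auto simp: is_arg_min_def not_less)
  then have "is_arg_min g (\<lambda>x. x \<in> S) (arg_min_on g S)"
    unfolding arg_min_on_def arg_min_def by (rule someI)
  then show "arg_min_on g S \<in> S" "\<And>y. y \<in> S \<Longrightarrow> g (arg_min_on g S) \<le> g y"
    by (auto simp: is_arg_min_def not_less)
qed

text \<open>Tychonoff's theorem. The index type may be infinite, as it is for \<open>vec\<close>,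
  hence a bound is required for each coordinate.\<close>

lemma compact_coordinate_box:
  fixes B :: "'i \<Rightarrow> real"
  shows "compact {x. \<forall>i. \<bar>x i\<bar> \<le> B i}"
proof -
  have "compact (PiE UNIV (\<lambda>i. {- B i..B i}))"
    using compactin_PiE[of "\<lambda>_. euclideanreal" UNIV "\<lambda>i. {- B i..B i}"]
    by (simp add: euclidean_product_topology)
  moreover have "PiE UNIV (\<lambda>i. {- B i..B i}) = {x. \<forall>i. \<bar>x i\<bar> \<le> B i}"
    by (auto simp: PiE_UNIV_domain Pi_iff abs_le_iff minus_le_iff)
  ultimately show ?thesis by simp
qed

text \<open>The direct method: the sublevel set of \<open>y0\<close> within \<open>S\<close> is
  closed and contained in a compact box. Points outside this set have a larger value than
  \<open>y0\<close> and cannot compete.\<close>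

lemma attains_inf_bounded_sublevel:
  fixes g :: "('i \<Rightarrow> real) \<Rightarrow> real"
  assumes "closed S" "y0 \<in> S" "continuous_on UNIV g"
    and "\<And>y i. y \<in> S \<Longrightarrow> g y \<le> g y0 \<Longrightarrow> \<bar>y i\<bar> \<le> B i"
  obtains x where "x \<in> S" "\<And>y. y \<in> S \<Longrightarrow> g x \<le> g y"
proof -
  let ?K = "{x. \<forall>i. \<bar>x i\<bar> \<le> B i} \<inter> (S \<inter> {y. g y \<le> g y0})"
  have "closed {y. g y \<le> g y0}"
    using assms(3) by (intro closed_Collect_le) (auto intro: continuous_intros)
  then have "compact ?K" using assms(1) compact_coordinate_box by blast
  moreover have "y0 \<in> ?K" using assms(2,4) by auto
  ultimately obtain x where x: "x \<in> ?K" "\<forall>y\<in>?K. g x \<le> g y"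
    using continuous_attains_inf[of ?K g] continuous_on_subset[OF assms(3)] by blast
  have "g x \<le> g y" if "y \<in> S" for y
  proof (cases "g y \<le> g y0")
    case True
    then have "y \<in> ?K" using that assms(4) by blast
    then show ?thesis using x(2) by blast
  next
    case False
    then show ?thesis using x(1) by simp
  qed
  then show ?thesis using that x(1) by blast
qed

lemma tendsto_coordinatewise:
  fixes x :: "'a \<Rightarrow> 'i \<Rightarrow> real"
  assumes "\<And>i. ((\<lambda>s. x s i) \<longlongrightarrow> y i) F"
  shows "(x \<longlongrightarrow> y) F"
proof -
  have "limitin (product_topology (\<lambda>_. euclideanreal) UNIV) x y F"
    using assms by (simp add: limitin_componentwise)
  then show ?thesis by (simp add: euclidean_product_topology)
qed

section \<open>Summation by parts along an interval\<close>

lemma telescope_interval: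
  fixes d :: "nat \<Rightarrow> real"
  assumes "a \<le> b"
  shows "(\<Sum>k=a..b. if k = a then d k else d k - d (k - 1)) = d b"
  using assms
proof (induction rule: dec_induct)
  case (step n)
  then show ?case by (simp add: sum.nat_ivl_Suc')
qed simp

text \<open>Induction on \<open>b\<close>: a new last index adds \<open>u (Suc n)\<close> to every
  tail sum, and these additions multiply increments that telescope to \<open>d (Suc n)\<close>. It
  is used to rewrite the gradient of \<open>f\<close> in terms of increments along a row or
  column.\<close>

lemma summation_by_parts:
  fixes u d :: "nat \<Rightarrow> real"
  shows "(\<Sum>k=a..b. u k * d k) =
    (\<Sum>k=a..b. (\<Sum>k'=k..b. u k') * (if k = a then d k else d k - d (k - 1)))"
proof (cases "a \<le> b")
  case True
  let ?x = "\<lambda>k. if k = a then d k else d k - d (k - 1)"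
  show ?thesis using True
  proof (induction rule: dec_induct)
    case (step n)
    have "(\<Sum>k=a..Suc n. (\<Sum>k'=k..Suc n. u k') * ?x k)
        = (\<Sum>k=a..n. (\<Sum>k'=k..Suc n. u k') * ?x k) + u (Suc n) * ?x (Suc n)"
      using step by (simp add: sum.nat_ivl_Suc')
    also have "(\<Sum>k=a..n. (\<Sum>k'=k..Suc n. u k') * ?x k)
        = (\<Sum>k=a..n. (\<Sum>k'=k..n. u k') * ?x k + u (Suc n) * ?x k)"
      by (intro sum.cong refl) (simp add: sum.nat_ivl_Suc' algebra_simps)
    also have "\<dots> = (\<Sum>k=a..n. u k * d k) + u (Suc n) * (\<Sum>k=a..n. ?x k)"
      using step.IH by (simp only: sum.distrib sum_distrib_left)
    finally have "(\<Sum>k=a..Suc n. (\<Sum>k'=k..Suc n. u k') * ?x k)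
        = (\<Sum>k=a..n. u k * d k) + u (Suc n) * (\<Sum>k=a..Suc n. ?x k)"
      using step by (simp add: sum.nat_ivl_Suc' algebra_simps)
    also have "(\<Sum>k=a..Suc n. ?x k) = d (Suc n)"
      using telescope_interval[of a "Suc n" d] step by simp
    finally show ?case using step by (simp add: sum.nat_ivl_Suc')
  qed simp
qed simp

text \<open>
  The parabola \<open>h t = a * t - co * t\<^sup>2\<close> interpolates \<open>\<rho>\<close> at \<open>to\<close>. If its maximizer lies beyond
  \<open>to\<close>, then \<open>\<rho> to \<ge> to * a / 2\<close>. Otherwise the maximizer is \<open>r * to\<close> with \<open>1/2 \<le> r \<le> 1\<close>, and
  either \<open>\<rho> to\<close> is large (\<open>r \<ge> 3/4\<close>) or the strong concavity of \<open>\<rho>\<close> gives the decrease.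
\<close>

lemma parabola_step_decrease:
  fixes \<rho> :: "real \<Rightarrow> real" and a to \<tau> c c1 Q :: real
  assumes to: "0 < to" "to \<le> 1" "\<tau> \<le> to" "0 < \<tau>"
    and "0 < Q" "0 < c" "0 < c1" "c1 * Q \<le> a"
    and nonneg: "0 \<le> \<rho> to"
    and upper: "\<rho> to < to * a"
    and conc: "\<And>r. 0 \<le> r \<Longrightarrow> r \<le> 1 \<Longrightarrow>
        r * \<rho> to + c / 2 * r * (1 - r) * to\<^sup>2 * Q \<le> \<rho> (r * to)"
    and c_def: "co = inverse to * (a - inverse to * \<rho> to)"
    and ts_def: "ts = min to (a / 2 / co)"
  shows "0 \<le> ts" "ts \<le> 1" "min (c1 * \<tau> / 4) (c * \<tau>\<^sup>2 / 16) * Q \<le> \<rho> ts"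
proof -
  have apos: "0 < a" using assms(5,7,8) by (meson less_le_trans mult_pos_pos)
  \<comment> \<open>In this form positivity follows from \<open>upper\<close>: the chord of
    \<open>\<rho>\<close> over the interval from \<open>0\<close> to \<open>to\<close> is less steep
    than \<open>a\<close>.\<close>
  have co: "co = (to * a - \<rho> to) / to\<^sup>2"
    using to by (simp add: c_def field_simps power2_eq_square)
  then have copos: "0 < co" using upper to by simp
  have ts: "0 \<le> ts" "ts \<le> to" using copos apos to by (auto simp: ts_def)
  then show "0 \<le> ts" "ts \<le> 1" using to by auto
  have "c1 * Q * \<tau> \<le> a * to" using assms apos by (intro mult_mono) auto
  then have at: "c1 * \<tau> * Q \<le> to * a" by (simp add: mult_ac)
  have tt: "\<tau>\<^sup>2 \<le> to\<^sup>2" using to by (intro power_mono) auto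
  let ?\<eta> = "min (c1 * \<tau> / 4) (c * \<tau>\<^sup>2 / 16)"
  have e1: "?\<eta> * Q \<le> c1 * \<tau> / 4 * Q" and e2: "?\<eta> * Q \<le> c * \<tau>\<^sup>2 / 16 * Q"
    using assms(5) by (intro mult_right_mono; simp)+
  have e0: "0 \<le> c1 * \<tau> * Q" using assms by simp
  show "?\<eta> * Q \<le> \<rho> ts"
  proof (cases "to \<le> a / 2 / co")
    case True
    then have "ts = to" by (simp add: ts_def)
    have "to * co \<le> a / 2" using True copos by (simp add: pos_le_divide_eq)
    then have "to * (to * co) \<le> to * (a / 2)" using to by (intro mult_left_mono) auto
    also have "to * (to * co) = to * a - \<rho> to" using to by (simp add: co power2_eq_square)
    finally have "to * a / 2 \<le> \<rho> to" by argo
    then show ?thesis using e1 at e0 \<open>ts = to\<close> by simp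
  next
    case False
    then have ts_eq: "ts = a / 2 / co" by (simp add: ts_def)
    define b where "b = \<rho> to"
    define r where "r = ts / to"
    have r_eq: "r = to * a / (2 * (to * a - b))"
      using to upper by (simp add: r_def ts_eq co b_def field_simps power2_eq_square)
    have rts: "ts = r * to" using to by (simp add: r_def)
    have r1: "r \<le> 1" using ts to by (simp add: r_def)
    \<comment> \<open>Here \<open>0 \<le> \<rho> to\<close> enters: the denominator in
      \<open>r_eq\<close> is at most twice the numerator.\<close>
    have r2: "1 / 2 \<le> r"
      using nonneg upper by (simp add: r_eq b_def field_simps)
    have rb: "r * b = to * a * (r - 1 / 2)"
      using upper by (simp add: r_eq b_def field_simps)
    have main: "r * b + c / 2 * r * (1 - r) * to\<^sup>2 * Q \<le> \<rho> ts"
      using conc[of r] r1 r2 by (simp add: rts b_def)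
    have tapos: "0 \<le> to * a" using to apos by simp
    show ?thesis
    proof (cases "3 / 4 \<le> r")
      case True
      have "to * a * (1 / 4) \<le> to * a * (r - 1 / 2)" using True tapos by (intro mult_left_mono) auto
      moreover have "0 \<le> c / 2 * r * (1 - r) * to\<^sup>2 * Q" using assms r1 r2 by simp
      ultimately show ?thesis using main rb at e1 by simp
    next
      case False
      have "0 \<le> r * b" using r2 nonneg by (simp add: b_def)
      \<comment> \<open>With \<open>1/2 \<le> r < 3/4\<close> the concavity term retains the factor
        \<open>1/8\<close>, which together with \<open>c / 2\<close> gives the \<open>c / 16\<close>
        of the bound.\<close>
      have "1 / 2 * (1 / 4) \<le> r * (1 - r)" using r2 False by (intro mult_mono) auto
      then have "c / 2 * Q * (1 / 8) * \<tau>\<^sup>2 \<le> c / 2 * Q * (r * (1 - r)) * to\<^sup>2"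
        using tt assms by (intro mult_mono mult_left_mono) auto
      then show ?thesis using main \<open>0 \<le> r * b\<close> e2 by (simp add: mult_ac)
    qed
  qed
qed

text \<open>Small powers of one half satisfy the test, so the least exponent exists. If it is
  positive, the preceding trial step \<open>2 * to\<close> failed, which is possible only above
  \<open>2 * \<kappa>\<close>.\<close>

lemma halving_step_lower_bound:
  fixes \<rho> :: "real \<Rightarrow> real"
  assumes nn: "\<And>t. 0 \<le> t \<Longrightarrow> t \<le> 1 \<Longrightarrow> t \<le> 2 * \<kappa> \<Longrightarrow> 0 \<le> \<rho> t" and "0 < \<kappa>"
    and to_def: "to = (1 / 2) ^ (LEAST N. 0 \<le> \<rho> ((1 / 2) ^ N))"
  shows "0 \<le> \<rho> to" "0 < to" "to \<le> 1" "min 1 \<kappa> \<le> to"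
proof -
  define N0 where "N0 = (LEAST N. 0 \<le> \<rho> ((1 / 2) ^ N))"
  have to: "to = (1 / 2) ^ N0" by (simp add: to_def N0_def)
  obtain N :: nat where "(1 / 2) ^ N < 2 * \<kappa>"
    using real_arch_pow_inv[of "2 * \<kappa>" "1 / 2"] assms(2) by auto
  then have "0 \<le> \<rho> ((1 / 2) ^ N)" by (intro nn) (auto simp: power_le_one)
  then show "0 \<le> \<rho> to" unfolding to_def by (rule LeastI)
  show "0 < to" "to \<le> 1" by (auto simp: to power_le_one)
  show "min 1 \<kappa> \<le> to"
  proof (cases N0)
    case 0
    then show ?thesis by (simp add: to)
  next
    case (Suc k)
    have "\<not> 0 \<le> \<rho> ((1 / 2) ^ k)"
      using not_less_Least[of k "\<lambda>N. 0 \<le> \<rho> ((1 / 2) ^ N)"] Suc by (simp add: N0_def)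
    then have "\<not> (1 / 2) ^ k \<le> 2 * \<kappa>" using nn[of "(1 / 2) ^ k"] by (auto simp: power_le_one)
    then show ?thesis by (simp add: to Suc)
  qed
qed

section \<open>The index set, the cone and the target function\<close>

locale lr_pos = lr_weights +
  assumes l_pos: "1 \<le> l"
    and row_pos: "j \<in> {1..l} \<Longrightarrow> 0 < (\<Sum>k=1..m. w j k)"
    and col_pos: "k \<in> {1..m} \<Longrightarrow> 0 < (\<Sum>j=1..l. w j k)"
begin

section \<open>Positive entries and the shape of the index set\<close>

lemma row_pos_entry:
  assumes "j \<in> {1..l}"
  obtains k where "k \<in> {1..m}" "0 < w j k"
proof -
  have "\<exists>k\<in>{1..m}. w j k \<noteq> 0" using row_pos[OF assms] by (metis sum.neutral less_irrefl)
  then show ?thesis using that by blast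
qed

lemma col_pos_entry:
  assumes "k \<in> {1..m}"
  obtains j where "j \<in> {1..l}" "0 < w j k"
proof -
  have "\<exists>j\<in>{1..l}. w j k \<noteq> 0" using col_pos[OF assms] by (metis sum.neutral less_irrefl)
  then show ?thesis using that by blast
qed

lemma weight_le_n_obs:
  assumes "j \<in> {1..l}" "k \<in> {1..m}"
  shows "w j k \<le> n_obs"
proof -
  have "w j k \<le> (\<Sum>k=1..m. w j k)" using assms(2) by (intro member_le_sum) auto
  also have "\<dots> \<le> n_obs" unfolding n_obs_def
    using assms(1) by (intro member_le_sum[of j _ "\<lambda>j. \<Sum>k=1..m. w j k"]) auto
  finally show ?thesis .
qed

lemma n_obs_ge_1: "1 \<le> real n_obs"
proof -
  obtain k where "k \<in> {1..m}" "0 < w 1 k" using row_pos_entry[of 1] l_pos by auto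
  then show ?thesis using weight_le_n_obs[of 1 k] l_pos by simp
qed

lemma \<P>_I:
  assumes "1 \<le> j1" "j1 \<le> j" "j \<le> j2" "j2 \<le> l" "1 \<le> k1" "k1 \<le> k" "k \<le> k2" "k2 \<le> m"
    and "0 < w j1 k2" "0 < w j2 k1"
  shows "(j, k) \<in> \<P>"
proof -
  have "\<exists>j1 j2 k1 k2. 1 \<le> j1 \<and> j1 \<le> j \<and> j \<le> j2 \<and> j2 \<le> l \<and>
      1 \<le> k1 \<and> k1 \<le> k \<and> k \<le> k2 \<and> k2 \<le> m \<and> w j1 k2 > 0 \<and> w j2 k1 > 0"
    by (intro exI[of _ j1] exI[of _ j2] exI[of _ k1] exI[of _ k2]) (use assms in simp)
  then show ?thesis using assms(1-8) by (simp add: \<P>_def)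
qed

lemma \<P>_E:
  assumes "(j, k) \<in> \<P>"
  obtains j1 j2 k1 k2 where "1 \<le> j1" "j1 \<le> j" "j \<le> j2" "j2 \<le> l"
    "1 \<le> k1" "k1 \<le> k" "k \<le> k2" "k2 \<le> m" "0 < w j1 k2" "0 < w j2 k1"
  using assms by (auto simp: \<P>_def)

lemma \<P>_range: "(j, k) \<in> \<P> \<Longrightarrow> j \<in> {1..l} \<and> k \<in> {1..m}"
  by (auto simp: \<P>_def)

lemma finite_\<P> [simp]: "finite \<P>"
  by (rule finite_subset[of _ "{1..l} \<times> {1..m}"]) (auto simp: \<P>_def)

lemma pos_in_\<P>: "j \<in> {1..l} \<Longrightarrow> k \<in> {1..m} \<Longrightarrow> 0 < w j k \<Longrightarrow> (j, k) \<in> \<P>"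
  using \<P>_I[of j j j k k k] by auto

text \<open>The positive cell with small row and large column that witnesses the first corner, and
  the one with large row and small column that witnesses the second, serve for every cell of the
  rectangle between them.\<close>

lemma \<P>_rectangle:
  assumes "(j1, k2) \<in> \<P>" "(j2, k1) \<in> \<P>" "j1 \<le> j" "j \<le> j2" "k1 \<le> k" "k \<le> k2"
  shows "(j, k) \<in> \<P>"
proof -
  obtain a b where "1 \<le> a" "a \<le> j1" "k2 \<le> b" "b \<le> m" "0 < w a b" using \<P>_E[OF assms(1)] by metis
  moreover obtain c d where "j2 \<le> c" "c \<le> l" "1 \<le> d" "d \<le> k1" "0 < w c d"
    using \<P>_E[OF assms(2)] by metis
  ultimately show ?thesis using assms(3-) by (intro \<P>_I[of a j c d k b]) auto
qed

text \<open>Row \<open>j\<close> has a positive entry, so the sets under \<open>Min\<close> and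
  \<open>Max\<close> are nonempty and both extrema are attained; the positive cells that attain them
  are the witnesses required by \<open>\<P>\<close>.\<close>

lemma row_interval:
  assumes "j \<in> {1..l}"
  shows "(j, k) \<in> \<P> \<longleftrightarrow> row_lo j \<le> k \<and> k \<le> row_hi j"
proof -
  let ?A = "{k \<in> {1..m}. \<exists>j'\<in>{j..l}. w j' k > 0}"
  let ?B = "{k \<in> {1..m}. \<exists>j'\<in>{1..j}. w j' k > 0}"
  obtain k0 where k0: "k0 \<in> {1..m}" "0 < w j k0" using row_pos_entry[OF assms] .
  have AB: "finite ?A" "finite ?B" "k0 \<in> ?A" "k0 \<in> ?B" using k0 assms by auto
  have lo: "row_lo j \<in> ?A" unfolding row_lo_def using AB by (intro Min_in) blast+
  have hi: "row_hi j \<in> ?B" unfolding row_hi_def using AB by (intro Max_in) blast+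
  show ?thesis
  proof
    assume "(j, k) \<in> \<P>"
    then obtain j1 j2 k1 k2 where h: "1 \<le> j1" "j1 \<le> j" "j \<le> j2" "j2 \<le> l"
      "1 \<le> k1" "k1 \<le> k" "k \<le> k2" "k2 \<le> m" "0 < w j1 k2" "0 < w j2 k1" by (rule \<P>_E)
    have "row_lo j \<le> k1" unfolding row_lo_def using h AB by (intro Min_le) auto
    moreover have "k2 \<le> row_hi j" unfolding row_hi_def using h AB by (intro Max_ge) auto
    ultimately show "row_lo j \<le> k \<and> k \<le> row_hi j" using h by simp
  next
    assume k: "row_lo j \<le> k \<and> k \<le> row_hi j"
    obtain j1 j2 where "j2 \<in> {j..l}" "0 < w j2 (row_lo j)" "j1 \<in> {1..j}" "0 < w j1 (row_hi j)"
      using lo hi by blast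
    then show "(j, k) \<in> \<P>" using k lo hi by (intro \<P>_I[of j1 j j2 "row_lo j" k "row_hi j"]) auto
  qed
qed

lemma col_interval:
  assumes "k \<in> {1..m}"
  shows "(j, k) \<in> \<P> \<longleftrightarrow> col_lo k \<le> j \<and> j \<le> col_hi k"
proof -
  let ?A = "{j \<in> {1..l}. \<exists>k'\<in>{k..m}. w j k' > 0}"
  let ?B = "{j \<in> {1..l}. \<exists>k'\<in>{1..k}. w j k' > 0}"
  obtain j0 where j0: "j0 \<in> {1..l}" "0 < w j0 k" using col_pos_entry[OF assms] .
  have AB: "finite ?A" "finite ?B" "j0 \<in> ?A" "j0 \<in> ?B" using j0 assms by auto
  have lo: "col_lo k \<in> ?A" unfolding col_lo_def using AB by (intro Min_in) blast+
  have hi: "col_hi k \<in> ?B" unfolding col_hi_def using AB by (intro Max_in) blast+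
  show ?thesis
  proof
    assume "(j, k) \<in> \<P>"
    then obtain j1 j2 k1 k2 where h: "1 \<le> j1" "j1 \<le> j" "j \<le> j2" "j2 \<le> l"
      "1 \<le> k1" "k1 \<le> k" "k \<le> k2" "k2 \<le> m" "0 < w j1 k2" "0 < w j2 k1" by (rule \<P>_E)
    have "col_lo k \<le> j1" unfolding col_lo_def using h AB by (intro Min_le) auto
    moreover have "j2 \<le> col_hi k" unfolding col_hi_def using h AB by (intro Max_ge) auto
    ultimately show "col_lo k \<le> j \<and> j \<le> col_hi k" using h by simp
  next
    assume j: "col_lo k \<le> j \<and> j \<le> col_hi k"
    obtain k1 k2 where "k2 \<in> {k..m}" "0 < w (col_lo k) k2" "k1 \<in> {1..k}" "0 < w (col_hi k) k1"
      using lo hi by blast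
    then show "(j, k) \<in> \<P>" using j lo hi by (intro \<P>_I[of "col_lo k" j "col_hi k" k1 k k2]) auto
  qed
qed

lemma sum_\<P>_rows: "(\<Sum>p\<in>\<P>. g p) = (\<Sum>j=1..l. \<Sum>k=row_lo j..row_hi j. g (j, k))"
proof -
  have "(j, k) \<in> \<P> \<longleftrightarrow> (j, k) \<in> Sigma {1..l} (\<lambda>j. {row_lo j..row_hi j})" for j k
    by (metis SigmaE2 SigmaI \<P>_range atLeastAtMost_iff row_interval)
  then have "\<P> = Sigma {1..l} (\<lambda>j. {row_lo j..row_hi j})" by auto
  then show ?thesis by (simp add: sum.Sigma)
qed

lemma sum_\<P>_cols: "(\<Sum>p\<in>\<P>. g p) = (\<Sum>k=1..m. \<Sum>j=col_lo k..col_hi k. g (j, k))"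
proof -
  have "(j, k) \<in> \<P> \<longleftrightarrow> (k, j) \<in> Sigma {1..m} (\<lambda>k. {col_lo k..col_hi k})" for j k
    by (metis SigmaE2 SigmaI \<P>_range atLeastAtMost_iff col_interval)
  then have "\<P> = prod.swap ` Sigma {1..m} (\<lambda>k. {col_lo k..col_hi k})" by force
  then have "(\<Sum>p\<in>\<P>. g p) = (\<Sum>p\<in>Sigma {1..m} (\<lambda>k. {col_lo k..col_hi k}). g (prod.swap p))"
    by (simp add: sum.reindex)
  then show ?thesis by (simp add: sum.Sigma case_prod_unfold prod.swap_def)
qed

section \<open>The cone of supermodular vectors\<close>

lemma \<Theta>_vecs: "\<theta> \<in> \<Theta> \<Longrightarrow> p \<notin> \<P> \<Longrightarrow> \<theta> p = 0"
  unfolding \<Theta>_def vecs_def by blast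

lemma zero_in_\<Theta>: "(\<lambda>_. 0) \<in> \<Theta>"
  by (simp add: \<Theta>_def vecs_def)

lemma closed_\<Theta>: "closed \<Theta>"
proof -
  have "\<Theta> = (\<Inter>p\<in>-\<P>. {\<theta>. \<theta> p = 0}) \<inter>
      (\<Inter>(j, k)\<in>{(j, k). 1 < j \<and> j \<le> l \<and> 1 < k \<and> k \<le> m \<and> (j - 1, k) \<in> \<P> \<and> (j, k - 1) \<in> \<P>}.
        {\<theta>. 0 \<le> \<theta> (j - 1, k - 1) + \<theta> (j, k) - \<theta> (j - 1, k) - \<theta> (j, k - 1)})"
    by (auto simp: \<Theta>_def vecs_def)
  moreover have "closed \<dots>"
    by (auto intro!: closed_Int closed_INT closed_Collect_eq closed_Collect_le continuous_intros)
  ultimately show ?thesis by simp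
qed

lemma segment_in_\<Theta>:
  assumes "x \<in> \<Theta>" "y \<in> \<Theta>" "0 \<le> t" "t \<le> 1"
  shows "segment_point x y t \<in> \<Theta>"
proof -
  let ?z = "segment_point x y t"
  have "0 \<le> ?z (j - 1, k - 1) + ?z (j, k) - ?z (j - 1, k) - ?z (j, k - 1)"
    if "1 < j \<and> j \<le> l \<and> 1 < k \<and> k \<le> m \<and> (j - 1, k) \<in> \<P> \<and> (j, k - 1) \<in> \<P>" for j k
  proof -
    have "?z (j - 1, k - 1) + ?z (j, k) - ?z (j - 1, k) - ?z (j, k - 1) =
        (1 - t) * (x (j - 1, k - 1) + x (j, k) - x (j - 1, k) - x (j, k - 1)) +
        t * (y (j - 1, k - 1) + y (j, k) - y (j - 1, k) - y (j, k - 1))"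
      by (simp add: segment_point_def algebra_simps)
    moreover have "0 \<le> x (j - 1, k - 1) + x (j, k) - x (j - 1, k) - x (j, k - 1)"
      "0 \<le> y (j - 1, k - 1) + y (j, k) - y (j - 1, k) - y (j, k - 1)"
      using that assms(1,2) by (auto simp: \<Theta>_def)
    ultimately show ?thesis using assms(3,4) by simp
  qed
  moreover have "?z \<in> vecs" using assms(1,2) by (simp add: \<Theta>_def vecs_def segment_point_def)
  ultimately show ?thesis unfolding \<Theta>_def by blast
qed

text \<open>The inequalities of all unit squares in the rectangle add up; by
  \<open>\<P>_rectangle\<close> each of these squares lies in \<open>\<P>\<close>. The fact
  \<open>strip\<close> adds them between two adjacent rows, and the outer induction stacks the
  strips.\<close>

lemma \<Theta>_supermodular:
  assumes \<theta>: "\<theta> \<in> \<Theta>" and P: "(j1, k2) \<in> \<P>" "(j2, k1) \<in> \<P>" and le: "j1 \<le> j2" "k1 \<le> k2"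
  shows "\<theta> (j1, k2) + \<theta> (j2, k1) \<le> \<theta> (j1, k1) + \<theta> (j2, k2)"
proof -
  have strip: "\<theta> (j, k) + \<theta> (Suc j, k1) \<le> \<theta> (j, k1) + \<theta> (Suc j, k)"
    if j: "j1 \<le> j" "j < j2" and k: "k1 \<le> k" "k \<le> k2" for j k
    using k
  proof (induction rule: dec_induct)
    case (step k)
    have "(j, Suc k) \<in> \<P>" "(Suc j, k) \<in> \<P>"
      using step j by (auto intro!: \<P>_rectangle[OF P])
    moreover have "0 < j" "0 < k" using \<P>_range[OF P(1)] \<P>_range[OF P(2)] j step by auto
    ultimately have "0 \<le> \<theta> (j, k) + \<theta> (Suc j, Suc k) - \<theta> (j, Suc k) - \<theta> (Suc j, k)"
      using \<theta> \<P>_range[of "Suc j" k] \<P>_range[of j "Suc k"]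
      unfolding \<Theta>_def mem_Collect_eq
      by (elim conjE allE[of _ "Suc j"] allE[of _ "Suc k"]) simp
    then show ?case using step by simp
  qed simp
  show ?thesis using le(1)
  proof (induction rule: dec_induct)
    case (step j)
    then show ?case using strip[of j k2] le(2) by simp
  qed simp
qed

section \<open>Coercivity of the target function on the cone\<close>

abbreviation "weight p \<equiv> real (w (fst p) (snd p))"
abbreviation "N \<equiv> real n_obs"

lemma f_eq: "f \<theta> = (\<Sum>p\<in>\<P>. - weight p * \<theta> p + N * exp (\<theta> p))"
  by (simp add: f_def case_prod_unfold)

text \<open>For \<open>t \<ge> 0\<close> the exponential dominates because
  \<open>weight p \<le> N\<close> and \<open>t \<le> exp t\<close>; for negative \<open>t\<close>
  both terms are nonnegative. Consequently a bound on \<open>f\<close> bounds each summand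
  separately.\<close>

lemma f_term_ge_0:
  fixes t :: real
  assumes "p \<in> \<P>"
  shows "0 \<le> - weight p * t + N * exp t"
proof -
  have wN: "weight p \<le> N" using weight_le_n_obs \<P>_range assms by (cases p) auto
  show ?thesis
  proof (cases "0 \<le> t")
    case True
    have "weight p * t \<le> N * t" using wN True by (intro mult_right_mono) auto
    also have "\<dots> \<le> N * exp t" using exp_ge_add_one_self[of t] by (intro mult_left_mono) linarith+
    finally show ?thesis by simp
  next
    case False
    then have "weight p * t \<le> 0" by (simp add: mult_le_0_iff)
    moreover have "0 \<le> N * exp t" by simp
    ultimately show ?thesis by linarith
  qed
qed

lemma f_nonneg: "0 \<le> f \<theta>"
  unfolding f_eq by (intro sum_nonneg f_term_ge_0)

lemma f_term_le:
  assumes "p \<in> \<P>"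
  shows "- weight p * \<theta> p + N * exp (\<theta> p) \<le> f \<theta>"
  unfolding f_eq using assms f_term_ge_0
  by (intro member_le_sum[of p \<P> "\<lambda>p. - weight p * \<theta> p + N * exp (\<theta> p)"]) auto

lemma continuous_f: "continuous_on UNIV f"
  unfolding f_eq by (intro continuous_intros) simp_all

text \<open>Squaring \<open>1 + t / 2 \<le> exp (t / 2)\<close> gives
  \<open>t + t\<^sup>2 / 4 \<le> exp t\<close>. The linear part absorbs \<open>weight p * t\<close>,
  and for \<open>t > 1\<close> the rest yields \<open>t \<le> t\<^sup>2 \<le> 4 * c\<close>.\<close>

lemma sublevel_upper:
  assumes p: "p \<in> \<P>" and c: "f \<theta> \<le> c"
  shows "\<theta> p \<le> 1 + 4 * c"
proof (cases "\<theta> p \<le> 1")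
  case True
  then show ?thesis using f_nonneg[of \<theta>] c by simp
next
  case False
  let ?t = "\<theta> p"
  have wN: "weight p \<le> N" using weight_le_n_obs \<P>_range p by (cases p) auto
  have "(1 + ?t / 2)\<^sup>2 \<le> (exp (?t / 2))\<^sup>2"
    using False exp_ge_add_one_self[of "?t / 2"] by (intro power_mono) auto
  also have "(exp (?t / 2))\<^sup>2 = exp ?t" by (simp flip: exp_double)
  finally have e: "?t + ?t\<^sup>2 / 4 \<le> exp ?t" by (simp add: power2_eq_square field_simps)
  have "?t \<le> ?t\<^sup>2" using False by (simp add: power2_eq_square)
  have "?t\<^sup>2 / 4 \<le> N * (?t\<^sup>2 / 4)" using mult_right_mono[OF n_obs_ge_1, of "?t\<^sup>2 / 4"] by simp
  also have "\<dots> = N * (?t + ?t\<^sup>2 / 4) - N * ?t" by (simp add: algebra_simps)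
  also have "\<dots> \<le> N * exp ?t - weight p * ?t"
    using e wN False by (intro diff_mono mult_left_mono mult_right_mono) auto
  also have "\<dots> \<le> c" using f_term_le[OF p, of \<theta>] c by simp
  finally show ?thesis using \<open>?t \<le> ?t\<^sup>2\<close> by simp
qed

text \<open>A positive count is at least one, so for negative \<open>\<theta> p\<close> the summand
  of \<open>p\<close> alone is at least \<open>- \<theta> p\<close>.\<close>

lemma sublevel_lower_pos:
  assumes p: "p \<in> \<P>" and "0 < w (fst p) (snd p)" and c: "f \<theta> \<le> c"
  shows "- (1 + 4 * c) \<le> \<theta> p"
proof (cases "0 \<le> \<theta> p")
  case True
  then show ?thesis using f_nonneg[of \<theta>] c by simp
next
  case False
  have "1 * (- \<theta> p) \<le> weight p * (- \<theta> p)" using assms(2) False by (intro mult_right_mono) auto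
  moreover have "weight p * (- \<theta> p) \<le> c"
  proof -
    have "0 \<le> N * exp (\<theta> p)" by simp
    then show ?thesis using f_term_le[OF p, of \<theta>] c by linarith
  qed
  ultimately show ?thesis using f_nonneg[of \<theta>] c by simp
qed

text \<open>
  A cell without observations is bounded from below by means of positive cells in its row and in
  its column, say \<open>(j, k')\<close> and \<open>(j', k)\<close>. If these lie on opposite sides of \<open>(j, k)\<close>, then a
  third positive cell, which exists by definition of \<open>\<P>\<close>, first yields a bound for a cell in the
  same row or column.
\<close>

lemma sublevel_bounded:
  assumes \<theta>: "\<theta> \<in> \<Theta>" and c: "f \<theta> \<le> c" and p: "p \<in> \<P>"
  shows "\<bar>\<theta> p\<bar> \<le> 5 * (1 + 4 * c)"
proof -
  \<comment> \<open>\<open>U\<close> bounds every cell from above and \<open>- U\<close> bounds the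
    positive cells from below. One use of supermodularity turns this into \<open>- 3 * U\<close>, a
    second one into \<open>- 5 * U\<close>.\<close>
  define U where "U = 1 + 4 * c"
  obtain j k where jk: "p = (j, k)" by (cases p)
  have U0: "0 \<le> U" using f_nonneg[of \<theta>] c by (simp add: U_def)
  have up: "\<theta> q \<le> U" if "q \<in> \<P>" for q using sublevel_upper[OF that c] by (simp add: U_def)
  have lo: "- U \<le> \<theta> (a, b)" if "(a, b) \<in> \<P>" "0 < w a b" for a b
    using sublevel_lower_pos[OF that(1) _ c] that(2) by (simp add: U_def)
  have P: "(j, k) \<in> \<P>" using p jk by simp
  note rng = \<P>_range[OF P]
  obtain k' where k': "k' \<in> {1..m}" "0 < w j k'" using row_pos_entry rng by blast
  obtain j' where j': "j' \<in> {1..l}" "0 < w j' k" using col_pos_entry rng by blast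
  have Pk: "(j, k') \<in> \<P>" and Pj: "(j', k) \<in> \<P>" using pos_in_\<P> k' j' rng by auto
  have bk: "- U \<le> \<theta> (j, k')" and bj: "- U \<le> \<theta> (j', k)" using lo Pk Pj k' j' by auto
  obtain j1 j2 k1 k2 where h: "1 \<le> j1" "j1 \<le> j" "j \<le> j2" "j2 \<le> l"
    "1 \<le> k1" "k1 \<le> k" "k \<le> k2" "k2 \<le> m" "0 < w j1 k2" "0 < w j2 k1" using \<P>_E[OF P] by metis
  have P12: "(j1, k2) \<in> \<P>" and P21: "(j2, k1) \<in> \<P>" using pos_in_\<P> h by auto
  have b12: "- U \<le> \<theta> (j1, k2)" and b21: "- U \<le> \<theta> (j2, k1)" using lo P12 P21 h by auto
  consider "j \<le> j'" "k \<le> k'" | "j' \<le> j" "k' \<le> k" | "j' \<le> j" "k \<le> k'" | "j \<le> j'" "k' \<le> k"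
    by linarith
  then have "- (5 * U) \<le> \<theta> (j, k)"
  proof cases
    case 1
    have "\<theta> (j, k') + \<theta> (j', k) \<le> \<theta> (j, k) + \<theta> (j', k')" using \<Theta>_supermodular[OF \<theta> Pk Pj 1] .
    moreover have "\<theta> (j', k') \<le> U" using 1 by (intro up \<P>_rectangle[OF Pk Pj]) auto
    ultimately show ?thesis using bk bj U0 by simp
  next
    case 2
    have "\<theta> (j', k) + \<theta> (j, k') \<le> \<theta> (j', k') + \<theta> (j, k)" using \<Theta>_supermodular[OF \<theta> Pj Pk 2] .
    moreover have "\<theta> (j', k') \<le> U" using 2 by (intro up \<P>_rectangle[OF Pj Pk]) auto
    ultimately show ?thesis using bk bj U0 by simp
  next
    case 3
    \<comment> \<open>The positive cell \<open>(j2, k1)\<close> bounds \<open>(j2, k)\<close>, a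
      cell of the same column with \<open>j \<le> j2\<close>. This cell then replaces
      \<open>(j', k)\<close> in the argument of the first case.\<close>
    have P2: "(j2, k) \<in> \<P>" "(j', k1) \<in> \<P>" using 3 h by (auto intro!: \<P>_rectangle[OF Pj P21])
    have "\<theta> (j', k) + \<theta> (j2, k1) \<le> \<theta> (j', k1) + \<theta> (j2, k)"
      using 3 h by (intro \<Theta>_supermodular[OF \<theta> Pj P21]) auto
    then have b: "- (3 * U) \<le> \<theta> (j2, k)" using bj b21 up[OF P2(2)] by simp
    have "\<theta> (j, k') + \<theta> (j2, k) \<le> \<theta> (j, k) + \<theta> (j2, k')"
      using 3 h by (intro \<Theta>_supermodular[OF \<theta> Pk P2(1)]) auto
    moreover have "\<theta> (j2, k') \<le> U" using 3 h by (intro up \<P>_rectangle[OF Pk P2(1)]) auto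
    ultimately show ?thesis using bk b by simp
  next
    case 4
    have P2: "(j, k2) \<in> \<P>" "(j1, k') \<in> \<P>" using 4 h by (auto intro!: \<P>_rectangle[OF P12 Pk])
    have "\<theta> (j1, k2) + \<theta> (j, k') \<le> \<theta> (j1, k') + \<theta> (j, k2)"
      using 4 h by (intro \<Theta>_supermodular[OF \<theta> P12 Pk]) auto
    then have b: "- (3 * U) \<le> \<theta> (j, k2)" using bk b12 up[OF P2(2)] by simp
    have "\<theta> (j, k2) + \<theta> (j', k) \<le> \<theta> (j, k) + \<theta> (j', k2)"
      using 4 h by (intro \<Theta>_supermodular[OF \<theta> P2(1) Pj]) auto
    moreover have "\<theta> (j', k2) \<le> U" using 4 h by (intro up \<P>_rectangle[OF P2(1) Pj]) auto
    ultimately show ?thesis using bj b by simp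
  qed
  moreover have "\<theta> (j, k) \<le> 5 * U" using up[OF P] U0 by simp
  ultimately show ?thesis by (simp add: jk U_def abs_le_iff)
qed

text \<open>The sublevel set of the zero vector is bounded in every coordinate, since coordinates
  outside \<open>\<P>\<close> vanish on \<open>\<Theta>\<close>.\<close>

lemma theta_hat_minimizes:
  shows "theta_hat \<in> \<Theta>" "\<And>y. y \<in> \<Theta> \<Longrightarrow> f theta_hat \<le> f y"
proof -
  have "\<bar>y i\<bar> \<le> 5 * (1 + 4 * f (\<lambda>_. 0))" if "y \<in> \<Theta>" "f y \<le> f (\<lambda>_. 0)" for y i
    using sublevel_bounded[OF that] \<Theta>_vecs[OF that(1)] f_nonneg[of "\<lambda>_. 0"]
    by (cases "i \<in> \<P>") auto
  then obtain x where x: "x \<in> \<Theta>" "\<And>y. y \<in> \<Theta> \<Longrightarrow> f x \<le> f y"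
    using attains_inf_bounded_sublevel[OF closed_\<Theta> zero_in_\<Theta> continuous_f,
        of "\<lambda>_. 5 * (1 + 4 * f (\<lambda>_. 0))"] by blast
  then show "theta_hat \<in> \<Theta>" "\<And>y. y \<in> \<Theta> \<Longrightarrow> f theta_hat \<le> f y"
    unfolding theta_hat_def using arg_min_on_minimizes[where g = f, OF x] by simp_all
qed

section \<open>Second-order expansion and first-order optimality\<close>

definition dir_deriv :: "vec \<Rightarrow> vec \<Rightarrow> real" where
  "dir_deriv \<theta> d = (\<Sum>p\<in>\<P>. (N * exp (\<theta> p) - weight p) * d p)"

definition sqnorm :: "vec \<Rightarrow> real" where
  "sqnorm d = (\<Sum>p\<in>\<P>. (d p)\<^sup>2)"

lemma dir_deriv_scale: "dir_deriv \<theta> (\<lambda>p. c * d p) = c * dir_deriv \<theta> d"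
  by (simp add: dir_deriv_def sum_distrib_left mult_ac)

lemma dir_deriv_add: "dir_deriv \<theta> (\<lambda>p. d p + e p) = dir_deriv \<theta> d + dir_deriv \<theta> e"
  by (simp add: dir_deriv_def distrib_left sum.distrib)

lemma sqnorm_scale: "sqnorm (\<lambda>p. c * d p) = c\<^sup>2 * sqnorm d"
  by (simp add: sqnorm_def sum_distrib_left power_mult_distrib)

lemma sqnorm_nonneg: "0 \<le> sqnorm d"
  by (simp add: sqnorm_def sum_nonneg)

text \<open>The linear parts of \<open>f\<close> cancel, leaving the Taylor remainders of the
  exponentials. The displacement is a separate variable \<open>d\<close> so that it can be given as
  a multiple of a fixed direction.\<close>

lemma f_taylor:
  assumes "\<And>p. p \<in> \<P> \<Longrightarrow> \<bar>x p\<bar> \<le> R" "\<And>p. p \<in> \<P> \<Longrightarrow> \<bar>y p\<bar> \<le> R" and d: "\<And>p. y p - x p = d p"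
  shows "N * exp (- (3 * R)) / 2 * sqnorm d \<le> f y - f x - dir_deriv x d"
    and "f y - f x - dir_deriv x d \<le> N * exp (3 * R) / 2 * sqnorm d"
proof -
  have e: "f y - f x - dir_deriv x d = (\<Sum>p\<in>\<P>. N * (exp (y p) - exp (x p) - exp (x p) * (y p - x p)))"
    unfolding f_eq dir_deriv_def d[symmetric] sum_subtractf[symmetric]
    by (intro sum.cong refl) (simp add: algebra_simps)
  have s: "C * sqnorm d = (\<Sum>p\<in>\<P>. C * (y p - x p)\<^sup>2)" for C
    by (simp add: sqnorm_def d sum_distrib_left)
  have "N * exp (- (3 * R)) / 2 * (y p - x p)\<^sup>2 \<le> N * (exp (y p) - exp (x p) - exp (x p) * (y p - x p))"
    "N * (exp (y p) - exp (x p) - exp (x p) * (y p - x p)) \<le> N * exp (3 * R) / 2 * (y p - x p)\<^sup>2"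
    if "p \<in> \<P>" for p
    using mult_left_mono[OF exp_taylor2(1)[OF assms(1,2)[OF that]], of N]
      mult_left_mono[OF exp_taylor2(2)[OF assms(1,2)[OF that]], of N] by simp_all
  then show "N * exp (- (3 * R)) / 2 * sqnorm d \<le> f y - f x - dir_deriv x d"
    "f y - f x - dir_deriv x d \<le> N * exp (3 * R) / 2 * sqnorm d"
    unfolding e s by (auto intro: sum_mono)
qed

lemma segment_bounded:
  assumes "\<bar>x p\<bar> \<le> R" "\<bar>y p\<bar> \<le> R" "0 \<le> t" "t \<le> 1"
  shows "\<bar>segment_point x y t p\<bar> \<le> R"
proof -
  have "\<bar>(1 - t) * x p + t * y p\<bar> \<le> (1 - t) * \<bar>x p\<bar> + t * \<bar>y p\<bar>"
    using abs_triangle_ineq[of "(1 - t) * x p" "t * y p"] assms(3,4) by (simp add: abs_mult)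
  also have "\<dots> \<le> (1 - t) * R + t * R"
    using assms by (intro add_mono mult_left_mono) auto
  finally show ?thesis by (simp add: segment_point_def algebra_simps)
qed

lemma bounded_on_\<P>_ex: obtains R where "\<And>p. p \<in> \<P> \<Longrightarrow> \<bar>x p\<bar> \<le> (R :: real)"
proof
  show "\<bar>x p\<bar> \<le> (\<Sum>p\<in>\<P>. \<bar>x p\<bar>)" if "p \<in> \<P>" for p using that by (intro member_le_sum) auto
qed

text \<open>Moving from \<open>theta_hat\<close> towards \<open>y\<close> stays in the cone and
  cannot decrease \<open>f\<close>; the upper Taylor bound makes this a quadratic inequality in the
  step length.\<close>

lemma theta_hat_optimal:
  assumes "y \<in> \<Theta>"
  shows "0 \<le> dir_deriv theta_hat (\<lambda>p. y p - theta_hat p)"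
proof -
  let ?x = theta_hat and ?d = "\<lambda>p. y p - theta_hat p"
  obtain R1 R2 where R: "\<And>p. p \<in> \<P> \<Longrightarrow> \<bar>?x p\<bar> \<le> R1" "\<And>p. p \<in> \<P> \<Longrightarrow> \<bar>y p\<bar> \<le> R2"
    using bounded_on_\<P>_ex by metis
  define R where "R = max R1 R2"
  have b: "\<bar>?x p\<bar> \<le> R" "\<bar>y p\<bar> \<le> R" if "p \<in> \<P>" for p using R[OF that] by (auto simp: R_def)
  show ?thesis
  proof (rule nonneg_of_quadratic_nonneg)
    fix \<epsilon> :: real assume e: "0 < \<epsilon>" "\<epsilon> \<le> 1"
    let ?z = "segment_point ?x y \<epsilon>"
    have "f ?z - f ?x - dir_deriv ?x (\<lambda>p. \<epsilon> * ?d p) \<le> N * exp (3 * R) / 2 * sqnorm (\<lambda>p. \<epsilon> * ?d p)"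
      using e b by (intro f_taylor(2) segment_bounded) (auto simp: segment_point_def algebra_simps)
    moreover have "f ?x \<le> f ?z"
      using e assms by (intro theta_hat_minimizes segment_in_\<Theta>) auto
    ultimately show "0 \<le> dir_deriv ?x ?d * \<epsilon> + N * exp (3 * R) / 2 * sqnorm ?d * \<epsilon>\<^sup>2"
      by (simp add: dir_deriv_scale sqnorm_scale mult_ac)
  qed
qed

end

section \<open>Proposals and step sizes\<close>

text \<open>The properties shared by the row and column constructions. \<open>dir_deriv_T\<close>
  says that \<open>v \<theta> p - W p\<close> are the components of the gradient with respect to the
  coordinates \<open>T\<close>; \<open>T_controls\<close> provides injectivity and coercivity; the
  bounds on \<open>v\<close> are uniform while \<open>\<theta>\<close> stays bounded.\<close>

locale lr_proposal = lr_pos +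
  fixes T :: "vec \<Rightarrow> vec" and v :: "vec \<Rightarrow> nat \<times> nat \<Rightarrow> real" and W :: "nat \<times> nat \<Rightarrow> real"
  assumes T_linear: "T (\<lambda>p. a * x p + b * y p) = (\<lambda>p. a * T x p + b * T y p)"
    and T_controls: "p \<in> \<P> \<Longrightarrow> \<bar>d p\<bar> \<le> (\<Sum>q\<in>\<P>. \<bar>T d q\<bar>)"
    and T_bounded: "(\<And>q. q \<in> \<P> \<Longrightarrow> \<bar>d q\<bar> \<le> B) \<Longrightarrow> p \<in> \<P> \<Longrightarrow> \<bar>T d p\<bar> \<le> 2 * B"
    and T_continuous: "continuous_on UNIV (\<lambda>d. T d p)"
    and dir_deriv_T: "dir_deriv \<theta> d = (\<Sum>p\<in>\<P>. (v \<theta> p - W p) * T d p)"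
    and v_lower: "p \<in> \<P> \<Longrightarrow> N * exp (\<theta> p) \<le> v \<theta> p"
    and v_upper: "(\<And>q. q \<in> \<P> \<Longrightarrow> exp (\<theta> q) \<le> B) \<Longrightarrow> p \<in> \<P> \<Longrightarrow> v \<theta> p \<le> N * (real (card \<P>) * B)"
begin

section \<open>Existence and variational inequality of the proposals\<close>

lemma T_diff: "T (\<lambda>p. x p - y p) = (\<lambda>p. T x p - T y p)"
  using T_linear[of 1 x "- 1" y] by simp

lemma T_segment: "T (segment_point x y t) = (\<lambda>p. (1 - t) * T x p + t * T y p)"
  unfolding segment_point_def by (rule T_linear)

lemma v_pos: "p \<in> \<P> \<Longrightarrow> 0 < v \<theta> p"
proof -
  assume "p \<in> \<P>"
  have "0 < N * exp (\<theta> p)" using n_obs_ge_1 by simp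
  then show ?thesis using v_lower[OF \<open>p \<in> \<P>\<close>, of \<theta>] by linarith
qed

lemma T_inj: "inj_on T vecs"
proof (rule inj_onI)
  fix x y assume xy: "x \<in> vecs" "y \<in> vecs" "T x = T y"
  show "x = y"
  proof
    fix p
    show "x p = y p"
    proof (cases "p \<in> \<P>")
      case True
      have "\<bar>x p - y p\<bar> \<le> (\<Sum>q\<in>\<P>. \<bar>T (\<lambda>p. x p - y p) q\<bar>)"
        using T_controls[OF True, of "\<lambda>p. x p - y p"] .
      then show ?thesis by (simp add: T_diff xy(3))
    next
      case False
      then show ?thesis using xy(1,2) unfolding vecs_def mem_Collect_eq by metis
    qed
  qed
qed

lemma proposal_minimizes:
  fixes \<theta> :: vec
  defines "\<gamma> \<equiv> \<lambda>p. T \<theta> p + inverse (v \<theta> p) * W p - 1"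
  defines "q \<equiv> \<lambda>y. \<Sum>p\<in>\<P>. v \<theta> p * (T y p - \<gamma> p)\<^sup>2"
  shows "proposal T v W \<theta> \<in> \<Theta>" "\<And>y. y \<in> \<Theta> \<Longrightarrow> q (proposal T v W \<theta>) \<le> q y"
proof -
  let ?c = "q (\<lambda>_. 0)" and ?g = "\<lambda>x. \<Sum>p\<in>\<P>. v \<theta> p * (x p - \<gamma> p)\<^sup>2"
  let ?B = "\<Sum>p\<in>\<P>. \<bar>\<gamma> p\<bar> + (1 + ?c / v \<theta> p)"
  have qn: "0 \<le> v \<theta> p * (T y p - \<gamma> p)\<^sup>2" if "p \<in> \<P>" for p y
    using v_pos[OF that, of \<theta>] by simp
  have c0: "0 \<le> ?c" unfolding q_def by (intro sum_nonneg qn)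
  have Tb: "\<bar>T y p\<bar> \<le> \<bar>\<gamma> p\<bar> + (1 + ?c / v \<theta> p)" if "q y \<le> ?c" "p \<in> \<P>" for y p
  proof -
    let ?z = "\<bar>T y p - \<gamma> p\<bar>"
    have "v \<theta> p * (T y p - \<gamma> p)\<^sup>2 \<le> q y"
      unfolding q_def using that qn by (intro member_le_sum[of p \<P> "\<lambda>p. v \<theta> p * (T y p - \<gamma> p)\<^sup>2"]) auto
    then have z2: "?z\<^sup>2 \<le> ?c / v \<theta> p"
      using that v_pos[of p \<theta>] by (simp add: pos_le_divide_eq mult.commute)
    \<comment> \<open>Gives a linear bound on \<open>?z\<close> from one on its square, without
      square roots.\<close>
    have "0 \<le> ?z\<^sup>2 + (1 - ?z)\<^sup>2" by simp
    then have "?z \<le> 1 + ?z\<^sup>2" by (auto simp: power2_eq_square algebra_simps)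
    then show ?thesis using z2 by linarith
  qed
  have "\<bar>y i\<bar> \<le> ?B" if "y \<in> \<Theta>" "q y \<le> ?c" for y i
  proof (cases "i \<in> \<P>")
    case True
    have "\<bar>y i\<bar> \<le> (\<Sum>p\<in>\<P>. \<bar>T y p\<bar>)" by (rule T_controls[OF True])
    also have "\<dots> \<le> ?B" using Tb[OF that(2)] by (intro sum_mono) auto
    finally show ?thesis .
  next
    case False
    have "0 \<le> ?B" using c0 v_pos[of _ \<theta>] by (intro sum_nonneg) (simp add: less_imp_le)
    then show ?thesis using False \<Theta>_vecs[OF that(1)] by simp
  qed
  moreover have "continuous_on UNIV q" unfolding q_def by (intro continuous_intros T_continuous)
  ultimately obtain x where x: "x \<in> \<Theta>" "\<And>y. y \<in> \<Theta> \<Longrightarrow> q x \<le> q y"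
    using attains_inf_bounded_sublevel[OF closed_\<Theta> zero_in_\<Theta>, of q "\<lambda>_. ?B"] by blast
  define x' where "x' = arg_min_on ?g (T ` \<Theta>)"
  have x': "x' \<in> T ` \<Theta>" "\<And>z. z \<in> T ` \<Theta> \<Longrightarrow> ?g x' \<le> ?g z"
    unfolding x'_def using x
    by (intro arg_min_on_minimizes[of "T x" "T ` \<Theta>" ?g]; auto simp: q_def)+
  then obtain y where y: "y \<in> \<Theta>" "x' = T y" by blast
  then have "y \<in> vecs" by (simp add: \<Theta>_def)
  then have "proposal T v W \<theta> = y"
    unfolding proposal_def Let_def \<gamma>_def[symmetric] x'_def[symmetric] y(2)
    using T_inj by (simp add: the_inv_into_f_f)
  then show "proposal T v W \<theta> \<in> \<Theta>" "\<And>y. y \<in> \<Theta> \<Longrightarrow> q (proposal T v W \<theta>) \<le> q y"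
    using x'(2) y by (auto simp: q_def)
qed

text \<open>First-order optimality along the segment from \<open>\<psi>\<close> to \<open>y\<close>.
  The centre \<open>\<gamma>\<close> is such that \<open>v * (T \<psi> - \<gamma>)\<close> splits
  into \<open>v - W\<close>, the gradient of \<open>f\<close> at \<open>\<theta>\<close>, and the
  curvature part \<open>v * (T \<psi> - T \<theta>)\<close>.\<close>

lemma proposal_variational_inequality:
  fixes \<theta> :: vec
  assumes "y \<in> \<Theta>"
  defines "\<psi> \<equiv> proposal T v W \<theta>"
  shows "0 \<le> dir_deriv \<theta> (\<lambda>p. y p - \<psi> p) + (\<Sum>p\<in>\<P>. v \<theta> p * ((T \<psi> p - T \<theta> p) * (T y p - T \<psi> p)))"
proof -
  define \<gamma> where "\<gamma> = (\<lambda>p. T \<theta> p + inverse (v \<theta> p) * W p - 1)"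
  define A where "A = (\<Sum>p\<in>\<P>. v \<theta> p * ((T \<psi> p - \<gamma> p) * (T y p - T \<psi> p)))"
  define B where "B = (\<Sum>p\<in>\<P>. v \<theta> p * (T y p - T \<psi> p)\<^sup>2)"
  have pm: "\<psi> \<in> \<Theta>" "\<And>y. y \<in> \<Theta> \<Longrightarrow>
      (\<Sum>p\<in>\<P>. v \<theta> p * (T \<psi> p - \<gamma> p)\<^sup>2) \<le> (\<Sum>p\<in>\<P>. v \<theta> p * (T y p - \<gamma> p)\<^sup>2)"
    using proposal_minimizes[where \<theta> = \<theta>] by (simp_all add: \<gamma>_def \<psi>_def)
  have "0 \<le> 2 * A"
  proof (rule nonneg_of_quadratic_nonneg)
    fix \<epsilon> :: real assume e: "0 < \<epsilon>" "\<epsilon> \<le> 1"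
    have "(\<Sum>p\<in>\<P>. v \<theta> p * (T \<psi> p - \<gamma> p)\<^sup>2)
        \<le> (\<Sum>p\<in>\<P>. v \<theta> p * (T (segment_point \<psi> y \<epsilon>) p - \<gamma> p)\<^sup>2)"
      using e assms pm(1) by (intro pm(2) segment_in_\<Theta>) auto
    also have "\<dots> = (\<Sum>p\<in>\<P>. v \<theta> p * (T \<psi> p - \<gamma> p)\<^sup>2 + 2 * \<epsilon> * (v \<theta> p * ((T \<psi> p - \<gamma> p) * (T y p - T \<psi> p)))
        + \<epsilon>\<^sup>2 * (v \<theta> p * (T y p - T \<psi> p)\<^sup>2))"
      by (intro sum.cong refl) (simp add: T_segment power2_eq_square algebra_simps)
    also have "\<dots> = (\<Sum>p\<in>\<P>. v \<theta> p * (T \<psi> p - \<gamma> p)\<^sup>2) + 2 * \<epsilon> * A + \<epsilon>\<^sup>2 * B"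
      by (simp only: sum.distrib sum_distrib_left A_def B_def)
    finally show "0 \<le> 2 * A * \<epsilon> + B * \<epsilon>\<^sup>2" by (simp add: mult_ac)
  qed
  moreover have "A = dir_deriv \<theta> (\<lambda>p. y p - \<psi> p)
      + (\<Sum>p\<in>\<P>. v \<theta> p * ((T \<psi> p - T \<theta> p) * (T y p - T \<psi> p)))"
    unfolding A_def dir_deriv_T T_diff sum.distrib[symmetric]
  proof (intro sum.cong refl)
    fix p assume "p \<in> \<P>"
    then have "v \<theta> p * \<gamma> p = v \<theta> p * T \<theta> p + W p - v \<theta> p"
      using v_pos[of p \<theta>] by (simp add: \<gamma>_def field_simps)
    then have g: "v \<theta> p * (T \<psi> p - \<gamma> p) = v \<theta> p - W p + v \<theta> p * (T \<psi> p - T \<theta> p)"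
      by (simp add: algebra_simps)
    have "v \<theta> p * ((T \<psi> p - \<gamma> p) * (T y p - T \<psi> p)) = (v \<theta> p * (T \<psi> p - \<gamma> p)) * (T y p - T \<psi> p)"
      by simp
    then show "v \<theta> p * ((T \<psi> p - \<gamma> p) * (T y p - T \<psi> p)) =
        (v \<theta> p - W p) * (T y p - T \<psi> p) + v \<theta> p * ((T \<psi> p - T \<theta> p) * (T y p - T \<psi> p))"
      unfolding g by (simp add: algebra_simps)
  qed
  ultimately show ?thesis by simp
qed

text \<open>Testing the variational inequality with \<open>y = \<theta>\<close> leaves the curvature
  term \<open>v \<theta> p * (T \<delta> p)\<^sup>2\<close> summed over \<open>\<P>\<close>. It
  dominates \<open>sqnorm\<close> by \<open>v_lower\<close>, \<open>T_controls\<close> and the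
  Cauchy-Schwarz inequality.\<close>

lemma descent_direction:
  fixes \<theta> :: vec
  assumes \<theta>: "\<theta> \<in> \<Theta>" and R: "\<And>p. p \<in> \<P> \<Longrightarrow> \<bar>\<theta> p\<bar> \<le> R"
  defines "\<psi> \<equiv> proposal T v W \<theta>"
  shows "N * exp (- R) / (1 + (real (card \<P>))\<^sup>2) * sqnorm (\<lambda>p. \<psi> p - \<theta> p)
    \<le> - dir_deriv \<theta> (\<lambda>p. \<psi> p - \<theta> p)"
proof -
  let ?\<delta> = "\<lambda>p. \<psi> p - \<theta> p" and ?K = "real (card \<P>)"
  let ?S = "\<Sum>q\<in>\<P>. (T ?\<delta> q)\<^sup>2"
  have "sqnorm ?\<delta> \<le> (\<Sum>p\<in>\<P>. ?S * ?K)" unfolding sqnorm_def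
  proof (rule sum_mono)
    fix p assume "p \<in> \<P>"
    then have "(?\<delta> p)\<^sup>2 \<le> (\<Sum>q\<in>\<P>. \<bar>T ?\<delta> q\<bar>)\<^sup>2"
      using T_controls[of p ?\<delta>] by (subst power2_abs[symmetric]) (intro power_mono, auto)
    also have "\<dots> \<le> ?S * ?K"
      using sum_squared_le_sum_of_squares[where f = "\<lambda>q. \<bar>T ?\<delta> q\<bar>" and I = \<P>] by simp
    finally show "(?\<delta> p)\<^sup>2 \<le> ?S * ?K" .
  qed
  \<comment> \<open>The extra \<open>1\<close> makes the factor visibly positive, so that it can be
    divided by.\<close>
  also have "\<dots> \<le> (1 + ?K\<^sup>2) * ?S"
    by (simp add: power2_eq_square algebra_simps sum_nonneg)
  finally have "sqnorm ?\<delta> / (1 + ?K\<^sup>2) \<le> ?S"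
    by (subst pos_divide_le_eq) (auto simp: mult.commute add_pos_nonneg)
  then have "N * exp (- R) * (sqnorm ?\<delta> / (1 + ?K\<^sup>2)) \<le> N * exp (- R) * ?S"
    by (intro mult_left_mono) auto
  also have "\<dots> \<le> (\<Sum>p\<in>\<P>. v \<theta> p * (T ?\<delta> p)\<^sup>2)"
    unfolding sum_distrib_left
  proof (intro sum_mono mult_right_mono)
    fix p assume p: "p \<in> \<P>"
    have "N * exp (- R) \<le> N * exp (\<theta> p)" using R[OF p] by (intro mult_left_mono) auto
    then show "N * exp (- R) \<le> v \<theta> p" using v_lower[OF p, of \<theta>] by simp
  qed simp
  also have "\<dots> = - (\<Sum>p\<in>\<P>. v \<theta> p * ((T \<psi> p - T \<theta> p) * (T \<theta> p - T \<psi> p)))"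
    unfolding T_diff sum_negf[symmetric]
    by (intro sum.cong refl) (simp add: power2_eq_square algebra_simps)
  also have "\<dots> \<le> dir_deriv \<theta> (\<lambda>p. \<theta> p - \<psi> p)"
    using proposal_variational_inequality[OF \<theta>, of \<theta>] by (simp add: \<psi>_def)
  also have "\<dots> = - dir_deriv \<theta> ?\<delta>"
    using dir_deriv_scale[of \<theta> "- 1" ?\<delta>] by simp
  finally show ?thesis by simp
qed

lemma dir_deriv_bound:
  assumes "\<And>p. p \<in> \<P> \<Longrightarrow> \<bar>\<theta> p\<bar> \<le> R"
  shows "\<bar>dir_deriv \<theta> d\<bar> \<le> N * (exp R + 1) * (\<Sum>p\<in>\<P>. \<bar>d p\<bar>)"
proof -
  have "\<bar>dir_deriv \<theta> d\<bar> \<le> (\<Sum>p\<in>\<P>. \<bar>(N * exp (\<theta> p) - weight p) * d p\<bar>)"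
    unfolding dir_deriv_def by (rule sum_abs)
  also have "\<dots> \<le> (\<Sum>p\<in>\<P>. N * (exp R + 1) * \<bar>d p\<bar>)"
    unfolding abs_mult
  proof (intro sum_mono mult_right_mono)
    fix p assume p: "p \<in> \<P>"
    have "weight p \<le> N" using weight_le_n_obs \<P>_range p by (cases p) auto
    moreover have "N * exp (\<theta> p) \<le> N * exp R" using assms[OF p] by (intro mult_left_mono) auto
    moreover have "0 \<le> N * exp (\<theta> p)" "0 \<le> N * exp R" by simp_all
    ultimately show "\<bar>N * exp (\<theta> p) - weight p\<bar> \<le> N * (exp R + 1)"
      unfolding distrib_left mult_1_right by linarith
  qed simp
  finally show ?thesis by (simp add: sum_distrib_left)
qed

text \<open>By \<open>descent_direction\<close> the directional derivative is at least quadratic in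
  the displacement, while by \<open>dir_deriv_bound\<close> it is at most linear. Hence the l1-norm
  of the displacement is at most \<open>G * K / c1\<close>.\<close>

lemma proposal_bounded:
  shows "\<exists>R'\<ge>R. \<forall>\<theta>\<in>\<Theta>. (\<forall>p\<in>\<P>. \<bar>\<theta> p\<bar> \<le> R) \<longrightarrow> (\<forall>p\<in>\<P>. \<bar>proposal T v W \<theta> p\<bar> \<le> R')"
proof -
  define K where "K = real (card \<P>)"
  define c1 where "c1 = N * exp (- R) / (1 + K\<^sup>2)"
  define G where "G = N * (exp R + 1)"
  have c1: "0 < c1" unfolding c1_def using n_obs_ge_1
    by (intro divide_pos_pos mult_pos_pos add_pos_nonneg) auto
  have G: "0 \<le> G" by (simp add: G_def)
  have "\<bar>proposal T v W \<theta> p\<bar> \<le> R + G * K / c1"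
    if \<theta>: "\<theta> \<in> \<Theta>" "\<And>p. p \<in> \<P> \<Longrightarrow> \<bar>\<theta> p\<bar> \<le> R" and p: "p \<in> \<P>" for \<theta> p
  proof -
    let ?\<delta> = "\<lambda>p. proposal T v W \<theta> p - \<theta> p"
    define s where "s = (\<Sum>p\<in>\<P>. \<bar>?\<delta> p\<bar>)"
    have s0: "0 \<le> s" by (simp add: s_def sum_nonneg)
    have "s\<^sup>2 \<le> sqnorm ?\<delta> * K"
      using sum_squared_le_sum_of_squares[where f = "\<lambda>p. \<bar>?\<delta> p\<bar>" and I = \<P>] by (simp add: s_def sqnorm_def K_def)
    then have le: "c1 * s\<^sup>2 \<le> c1 * (sqnorm ?\<delta> * K)" using c1 by (intro mult_left_mono) auto
    have "\<bar>dir_deriv \<theta> ?\<delta>\<bar> \<le> G * s"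
      unfolding G_def s_def by (rule dir_deriv_bound) (rule \<theta>(2))
    moreover have "c1 * sqnorm ?\<delta> \<le> - dir_deriv \<theta> ?\<delta>"
      unfolding c1_def K_def by (rule descent_direction[OF \<theta>])
    ultimately have "(c1 * sqnorm ?\<delta>) * K \<le> (G * s) * K"
      by (intro mult_right_mono) (auto simp: K_def)
    note le
    also have "c1 * (sqnorm ?\<delta> * K) = (c1 * sqnorm ?\<delta>) * K" by simp
    also note \<open>(c1 * sqnorm ?\<delta>) * K \<le> (G * s) * K\<close>
    finally have "s * (c1 * s) \<le> s * (G * K)" by (simp add: power2_eq_square mult_ac)
    then have "s \<le> G * K / c1"
      using c1 G s0 by (cases "s = 0") (auto simp: K_def pos_le_divide_eq mult.commute)
    moreover have "\<bar>?\<delta> p\<bar> \<le> s" unfolding s_def using p by (intro member_le_sum) auto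
    ultimately show ?thesis using \<theta>(2)[OF p] by linarith
  qed
  moreover have "R \<le> R + G * K / c1" using c1 G by (simp add: K_def)
  ultimately show ?thesis by blast
qed

text \<open>By convexity the gap is at most minus the derivative towards \<open>theta_hat\<close>, a
  direction that splits at the proposal. The variational inequality handles the part from the
  proposal to \<open>theta_hat\<close>, whose transform is uniformly bounded; the other part is the
  displacement itself. Both are linear in its l1-norm \<open>s\<close>.\<close>

lemma optimality_gap:
  shows "\<exists>C. \<forall>\<theta>\<in>\<Theta>. (\<forall>p\<in>\<P>. \<bar>\<theta> p\<bar> \<le> R) \<longrightarrow>
    f \<theta> - f theta_hat \<le> C * sqrt (sqnorm (\<lambda>p. proposal T v W \<theta> p - \<theta> p))"
proof -
  obtain R' where R': "R \<le> R'"
    "\<And>\<theta> p. \<theta> \<in> \<Theta> \<Longrightarrow> (\<forall>p\<in>\<P>. \<bar>\<theta> p\<bar> \<le> R) \<Longrightarrow> p \<in> \<P> \<Longrightarrow> \<bar>proposal T v W \<theta> p\<bar> \<le> R'"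
    using proposal_bounded[of R] by blast
  obtain R0 where R0: "\<And>p. p \<in> \<P> \<Longrightarrow> \<bar>theta_hat p\<bar> \<le> R0" using bounded_on_\<P>_ex by blast
  define K where "K = real (card \<P>)"
  define V where "V = N * (K * exp R)"
  define G where "G = N * (exp R + 1)"
  define C where "C = K * (V * (2 * (2 * (R0 + R')))) + G"
  have "f \<theta> - f theta_hat \<le> (\<bar>C\<bar> * sqrt K) * sqrt (sqnorm (\<lambda>p. proposal T v W \<theta> p - \<theta> p))"
    if \<theta>: "\<theta> \<in> \<Theta>" "\<forall>p\<in>\<P>. \<bar>\<theta> p\<bar> \<le> R" for \<theta>
  proof -
    define \<psi> where "\<psi> = proposal T v W \<theta>"
    let ?\<delta> = "\<lambda>p. \<psi> p - \<theta> p" and ?e = "\<lambda>p. theta_hat p - \<psi> p"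
    define s where "s = (\<Sum>p\<in>\<P>. \<bar>?\<delta> p\<bar>)"
    have s0: "0 \<le> s" by (simp add: s_def sum_nonneg)
    have "0 \<le> N * exp (- (3 * max R R0)) / 2 * sqnorm (\<lambda>p. theta_hat p - \<theta> p)"
      by (simp add: sqnorm_nonneg)
    also have "\<dots> \<le> f theta_hat - f \<theta> - dir_deriv \<theta> (\<lambda>p. theta_hat p - \<theta> p)"
      using \<theta>(2) R0 by (intro f_taylor(1)) (auto simp: le_max_iff_disj)
    finally have "f \<theta> - f theta_hat \<le> - dir_deriv \<theta> (\<lambda>p. ?e p + ?\<delta> p)" by simp
    then have split: "f \<theta> - f theta_hat \<le> - dir_deriv \<theta> ?e - dir_deriv \<theta> ?\<delta>"
      by (simp only: dir_deriv_add)
    have "- dir_deriv \<theta> ?e \<le> (\<Sum>p\<in>\<P>. v \<theta> p * (T ?\<delta> p * T ?e p))"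
      using proposal_variational_inequality[OF theta_hat_minimizes(1), of \<theta>]
      by (simp add: \<psi>_def T_diff)
    also have "\<dots> \<le> (\<Sum>p\<in>\<P>. V * ((2 * s) * (2 * (R0 + R'))))"
    proof (rule sum_mono)
      fix p assume p: "p \<in> \<P>"
      have d: "\<bar>T ?\<delta> p\<bar> \<le> 2 * s"
        by (rule T_bounded[OF _ p]) (auto simp: s_def intro: member_le_sum)
      have "\<bar>?e q\<bar> \<le> R0 + R'" if "q \<in> \<P>" for q
        using R0[OF that] R'(2)[OF \<theta> that] by (simp add: \<psi>_def)
      then have e: "\<bar>T ?e p\<bar> \<le> 2 * (R0 + R')" by (rule T_bounded[OF _ p])
      have "v \<theta> p \<le> V" unfolding V_def K_def using \<theta>(2) by (intro v_upper p) (auto simp: abs_le_iff)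
      have "T ?\<delta> p * T ?e p \<le> \<bar>T ?\<delta> p\<bar> * \<bar>T ?e p\<bar>" by (simp flip: abs_mult)
      also have "\<dots> \<le> (2 * s) * (2 * (R0 + R'))" using d e s0 by (intro mult_mono) auto
      finally have a: "T ?\<delta> p * T ?e p \<le> (2 * s) * (2 * (R0 + R'))" .
      have "v \<theta> p * (T ?\<delta> p * T ?e p) \<le> v \<theta> p * ((2 * s) * (2 * (R0 + R')))"
        using a v_pos[OF p, of \<theta>] by (intro mult_left_mono) auto
      also have "\<dots> \<le> V * ((2 * s) * (2 * (R0 + R')))"
        using \<open>v \<theta> p \<le> V\<close> s0 order_trans[OF abs_ge_zero e] by (intro mult_right_mono) auto
      finally show "v \<theta> p * (T ?\<delta> p * T ?e p) \<le> V * ((2 * s) * (2 * (R0 + R')))" .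
    qed
    finally have e_le: "- dir_deriv \<theta> ?e \<le> (\<Sum>p\<in>\<P>. V * ((2 * s) * (2 * (R0 + R'))))" .
    have "\<bar>dir_deriv \<theta> ?\<delta>\<bar> \<le> G * s"
      unfolding G_def s_def by (rule dir_deriv_bound) (use \<theta>(2) in blast)
    then have "f \<theta> - f theta_hat \<le> (\<Sum>p\<in>\<P>. V * ((2 * s) * (2 * (R0 + R')))) + G * s"
      using split e_le by linarith
    also have "\<dots> = C * s" by (simp add: C_def K_def algebra_simps)
    also have "\<dots> \<le> \<bar>C\<bar> * s" using s0 by (intro mult_right_mono) auto
    finally have "f \<theta> - f theta_hat \<le> \<bar>C\<bar> * s" .
    moreover have "s \<le> sqrt K * sqrt (sqnorm ?\<delta>)"
      unfolding real_sqrt_mult[symmetric]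
      using sum_squared_le_sum_of_squares[where f = "\<lambda>p. \<bar>?\<delta> p\<bar>" and I = \<P>]
      by (intro real_le_rsqrt) (simp add: s_def sqnorm_def K_def mult.commute)
    then have "\<bar>C\<bar> * s \<le> \<bar>C\<bar> * (sqrt K * sqrt (sqnorm ?\<delta>))" by (intro mult_left_mono) auto
    ultimately show ?thesis by (simp add: \<psi>_def mult.assoc)
  qed
  then show ?thesis by blast
qed

end

section \<open>Strong convexity along segments and at the minimizer\<close>

context lr_pos
begin

lemma sqnorm_eq_0:
  assumes "x \<in> \<Theta>" "y \<in> \<Theta>" "sqnorm (\<lambda>p. x p - y p) = 0"
  shows "x = y"
proof
  fix p
  have "\<forall>p\<in>\<P>. (x p - y p)\<^sup>2 = 0"
    using assms(3) unfolding sqnorm_def by (subst (asm) sum_nonneg_eq_0_iff) auto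
  then show "x p = y p"
    using \<Theta>_vecs[OF assms(1), of p] \<Theta>_vecs[OF assms(2), of p] by (cases "p \<in> \<P>") auto
qed

text \<open>In the lower Taylor bound at \<open>theta_hat\<close> the first-order term is
  nonnegative by \<open>theta_hat_optimal\<close>. In particular, the minimizer is unique.\<close>

lemma strong_minimality:
  shows "\<exists>c>0. \<forall>\<theta>\<in>\<Theta>. (\<forall>p\<in>\<P>. \<bar>\<theta> p\<bar> \<le> R) \<longrightarrow>
    c * sqnorm (\<lambda>p. \<theta> p - theta_hat p) \<le> f \<theta> - f theta_hat"
proof -
  obtain R0 where R0: "\<And>p. p \<in> \<P> \<Longrightarrow> \<bar>theta_hat p\<bar> \<le> R0" using bounded_on_\<P>_ex by blast
  let ?c = "N * exp (- (3 * max R R0)) / 2"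
  have "?c * sqnorm (\<lambda>p. \<theta> p - theta_hat p) \<le> f \<theta> - f theta_hat"
    if "\<theta> \<in> \<Theta>" "\<forall>p\<in>\<P>. \<bar>\<theta> p\<bar> \<le> R" for \<theta>
  proof -
    have "?c * sqnorm (\<lambda>p. \<theta> p - theta_hat p)
        \<le> f \<theta> - f theta_hat - dir_deriv theta_hat (\<lambda>p. \<theta> p - theta_hat p)"
      using that R0 by (intro f_taylor(1)) (auto simp: le_max_iff_disj)
    then show ?thesis using theta_hat_optimal[OF that(1)] by simp
  qed
  moreover have "0 < ?c" using n_obs_ge_1 by simp
  ultimately show ?thesis by blast
qed

lemma f_segment_deriv:
  "((\<lambda>t. f (segment_point x y t)) has_real_derivative dir_deriv x (\<lambda>p. y p - x p)) (at 0)"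
  unfolding f_eq segment_point_def dir_deriv_def
  by (auto intro!: derivative_eq_intros sum.cong simp: algebra_simps)

text \<open>Expansion at the intermediate point towards both endpoints, weighted with
  \<open>1 - r\<close> and \<open>r\<close>: the first-order terms cancel, and the quadratic ones
  combine since \<open>(1 - r) * r\<^sup>2 + r * (1 - r)\<^sup>2 = r * (1 - r)\<close>.\<close>

lemma f_segment_strongly_convex:
  assumes b: "\<And>p. p \<in> \<P> \<Longrightarrow> \<bar>x p\<bar> \<le> R" "\<And>p. p \<in> \<P> \<Longrightarrow> \<bar>y p\<bar> \<le> R" and r: "0 \<le> r" "r \<le> 1"
  shows "f (segment_point x y r) + N * exp (- (3 * R)) / 2 * (r * (1 - r)) * sqnorm (\<lambda>p. y p - x p)
    \<le> (1 - r) * f x + r * f y"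
proof -
  let ?z = "segment_point x y r" and ?d = "\<lambda>p. y p - x p"
  define c D Q where "c = N * exp (- (3 * R)) / 2" and "D = dir_deriv ?z ?d" and "Q = sqnorm ?d"
  have z: "\<bar>?z p\<bar> \<le> R" if "p \<in> \<P>" for p
    by (intro segment_bounded b that r)
  have "c * sqnorm (\<lambda>p. - r * ?d p) \<le> f x - f ?z - dir_deriv ?z (\<lambda>p. - r * ?d p)"
    unfolding c_def by (intro f_taylor(1) z b) (auto simp: segment_point_def algebra_simps)
  then have x: "c * (r\<^sup>2 * Q) \<le> f x - f ?z + r * D"
    unfolding dir_deriv_scale sqnorm_scale D_def Q_def by simp
  have "c * sqnorm (\<lambda>p. (1 - r) * ?d p) \<le> f y - f ?z - dir_deriv ?z (\<lambda>p. (1 - r) * ?d p)"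
    unfolding c_def by (intro f_taylor(1) z b) (auto simp: segment_point_def algebra_simps)
  then have y: "c * ((1 - r)\<^sup>2 * Q) \<le> f y - f ?z - (1 - r) * D"
    unfolding dir_deriv_scale sqnorm_scale D_def Q_def by simp
  have "(1 - r) * (c * (r\<^sup>2 * Q)) + r * (c * ((1 - r)\<^sup>2 * Q))
      \<le> (1 - r) * (f x - f ?z + r * D) + r * (f y - f ?z - (1 - r) * D)"
    using r by (intro add_mono mult_left_mono x y) auto
  also have "\<dots> = (1 - r) * f x + r * f y - f ?z" by (simp add: algebra_simps)
  also have "(1 - r) * (c * (r\<^sup>2 * Q)) + r * (c * ((1 - r)\<^sup>2 * Q)) = c * (r * (1 - r)) * Q"
    by (simp add: power2_eq_square algebra_simps)
  finally show ?thesis by (simp add: c_def Q_def)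
qed

end

section \<open>Uniform decrease in one step\<close>

context lr_proposal
begin

abbreviation "\<Psi> \<equiv> proposal T v W"

lemma proposal_in_\<Theta>: "\<Psi> \<theta> \<in> \<Theta>"
  by (rule proposal_minimizes(1))

lemma t_star_decrease:
  shows "\<exists>\<eta>>0. \<forall>\<theta>\<in>\<Theta>. (\<forall>p\<in>\<P>. \<bar>\<theta> p\<bar> \<le> R) \<and> 0 < sqnorm (\<lambda>p. \<Psi> \<theta> p - \<theta> p) \<longrightarrow>
    0 \<le> t_star \<Psi> \<theta> \<and> t_star \<Psi> \<theta> \<le> 1 \<and>
    \<eta> * sqnorm (\<lambda>p. \<Psi> \<theta> p - \<theta> p) \<le> \<rho> \<Psi> \<theta> (t_star \<Psi> \<theta>)"
proof -
  obtain R' where R': "R \<le> R'"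
    "\<And>\<theta> p. \<theta> \<in> \<Theta> \<Longrightarrow> (\<forall>p\<in>\<P>. \<bar>\<theta> p\<bar> \<le> R) \<Longrightarrow> p \<in> \<P> \<Longrightarrow> \<bar>\<Psi> \<theta> p\<bar> \<le> R'"
    using proposal_bounded[of R] by blast
  define c1 where "c1 = N * exp (- R) / (1 + (real (card \<P>))\<^sup>2)"
  define c where "c = N * exp (- (3 * R'))"
  define C where "C = N * exp (3 * R')"
  \<comment> \<open>Initial slope over maximal curvature: no step up to \<open>2 * (c1 / C)\<close>
    fails the test, so halving stops at \<open>\<tau>\<close> or above.\<close>
  define \<tau> where "\<tau> = min 1 (c1 / C)"
  have pos: "0 < c1" "0 < c" "0 < C" unfolding c1_def c_def C_def using n_obs_ge_1
    by (auto intro!: divide_pos_pos add_pos_nonneg)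
  then have \<tau>: "0 < \<tau>" by (simp add: \<tau>_def)
  let ?\<eta> = "min (c1 * \<tau> / 4) (c * \<tau>\<^sup>2 / 16)"
  have "0 \<le> t_star \<Psi> \<theta> \<and> t_star \<Psi> \<theta> \<le> 1 \<and>
      ?\<eta> * sqnorm (\<lambda>p. \<Psi> \<theta> p - \<theta> p) \<le> \<rho> \<Psi> \<theta> (t_star \<Psi> \<theta>)"
    if \<theta>: "\<theta> \<in> \<Theta>" "\<forall>p\<in>\<P>. \<bar>\<theta> p\<bar> \<le> R" and Qpos: "0 < sqnorm (\<lambda>p. \<Psi> \<theta> p - \<theta> p)" for \<theta>
  proof -
    let ?\<delta> = "\<lambda>p. \<Psi> \<theta> p - \<theta> p" and ?\<rho> = "\<rho> \<Psi> \<theta>" and ?s = "segment_point \<theta> (\<Psi> \<theta>)"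
    define Q a where "Q = sqnorm ?\<delta>" and "a = - dir_deriv \<theta> ?\<delta>"
    have b: "\<bar>\<theta> p\<bar> \<le> R'" "\<bar>\<Psi> \<theta> p\<bar> \<le> R'" if "p \<in> \<P>" for p
      using R'(1) R'(2)[OF \<theta> that] \<theta>(2) that by (auto intro: order_trans)
    have sb: "\<bar>?s t p\<bar> \<le> R'" if "p \<in> \<P>" "0 \<le> t" "t \<le> 1" for t p
      by (intro segment_bounded b that)
    have a: "c1 * Q \<le> a"
      unfolding c1_def Q_def a_def using \<theta> by (intro descent_direction) auto
    have "(?\<rho> has_real_derivative a) (at 0)"
      unfolding \<rho>_def a_def using f_segment_deriv by (auto intro!: derivative_eq_intros)
    then have deriv: "deriv ?\<rho> 0 = a" by (rule DERIV_imp_deriv)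
    have taylor: "t * a - C / 2 * t\<^sup>2 * Q \<le> ?\<rho> t" "?\<rho> t \<le> t * a - c / 2 * t\<^sup>2 * Q"
      if t: "0 \<le> t" "t \<le> 1" for t
      using f_taylor[of \<theta> R' "?s t" "\<lambda>p. t * ?\<delta> p", OF b(1) sb[OF _ t]]
      unfolding dir_deriv_scale sqnorm_scale
      by (simp_all add: segment_point_def \<rho>_def a_def Q_def c_def C_def algebra_simps)
    have "0 \<le> ?\<rho> t" if t: "0 \<le> t" "t \<le> 1" "t \<le> 2 * (c1 / C)" for t
    proof -
      have "C / 2 * t \<le> c1" using t(3) pos by (simp add: field_simps)
      then have "C / 2 * t * Q \<le> c1 * Q" using Qpos by (intro mult_right_mono) (auto simp: Q_def)
      then have "0 \<le> t * (a - C / 2 * t * Q)" using a t by simp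
      then show ?thesis using taylor(1)[OF t(1,2)] by (simp add: algebra_simps power2_eq_square)
    qed
    note to = halving_step_lower_bound[of "c1 / C" ?\<rho> "t_o \<Psi> \<theta>", OF this _ t_o_def, folded \<tau>_def]
    have to': "0 \<le> ?\<rho> (t_o \<Psi> \<theta>)" "0 < t_o \<Psi> \<theta>" "t_o \<Psi> \<theta> \<le> 1" "\<tau> \<le> t_o \<Psi> \<theta>"
      using to pos by simp_all
    \<comment> \<open>Strict concavity of \<open>\<rho>\<close>; it makes \<open>c_o\<close>
      positive and thus the parabola of the step size rule genuinely concave.\<close>
    have strict: "?\<rho> (t_o \<Psi> \<theta>) < t_o \<Psi> \<theta> * a"
    proof -
      have "0 < c / 2 * (t_o \<Psi> \<theta>)\<^sup>2 * Q" using pos to'(2) Qpos by (simp add: Q_def)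
      then show ?thesis using taylor(2)[of "t_o \<Psi> \<theta>"] to' by simp
    qed
    have conc: "r * ?\<rho> t + c / 2 * r * (1 - r) * t\<^sup>2 * Q \<le> ?\<rho> (r * t)"
      if r: "0 \<le> r" "r \<le> 1" and t: "0 \<le> t" "t \<le> 1" for r t
    proof -
      have "f (segment_point \<theta> (?s t) r) + c / 2 * (r * (1 - r)) * sqnorm (\<lambda>p. ?s t p - \<theta> p)
          \<le> (1 - r) * f \<theta> + r * f (?s t)"
        unfolding c_def by (intro f_segment_strongly_convex b(1) sb r t)
      \<comment> \<open>The segment to an intermediate point is part of the whole segment, so strong
        convexity applies with the shorter displacement \<open>t * \<delta>\<close>.\<close>
      moreover have "segment_point \<theta> (?s t) r = ?s (r * t)"
        by (auto simp: segment_point_def algebra_simps)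
      moreover have "(\<lambda>p. ?s t p - \<theta> p) = (\<lambda>p. t * ?\<delta> p)"
        by (auto simp: segment_point_def algebra_simps)
      then have "sqnorm (\<lambda>p. ?s t p - \<theta> p) = t\<^sup>2 * Q" by (simp only: sqnorm_scale Q_def)
      ultimately show ?thesis by (simp add: \<rho>_def algebra_simps)
    qed
    show ?thesis
      using parabola_step_decrease[of "t_o \<Psi> \<theta>" \<tau> Q c c1 a ?\<rho> "c_o \<Psi> \<theta>" "t_star \<Psi> \<theta>"]
        to' \<tau> Qpos pos a strict conc[of _ "t_o \<Psi> \<theta>"] c_o_def[of \<Psi> \<theta>] t_star_def[of \<Psi> \<theta>]
      by (simp add: deriv Q_def)
  qed
  moreover have "0 < ?\<eta>" using pos \<tau> by simp
  ultimately show ?thesis by blast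
qed

lemma step_estimates:
  shows "\<exists>\<eta>>0. \<exists>C. \<forall>\<theta>\<in>\<Theta>. (\<forall>p\<in>\<P>. \<bar>\<theta> p\<bar> \<le> R) \<longrightarrow>
    (\<forall>t\<in>step_sizes \<Psi> \<theta>. segment_point \<theta> (\<Psi> \<theta>) t \<in> \<Theta> \<and>
      \<eta> * sqnorm (\<lambda>p. \<Psi> \<theta> p - \<theta> p) \<le> f \<theta> - f (segment_point \<theta> (\<Psi> \<theta>) t)) \<and>
    f \<theta> - f theta_hat \<le> C * sqrt (sqnorm (\<lambda>p. \<Psi> \<theta> p - \<theta> p))"
proof -
  obtain \<eta> where \<eta>: "0 < \<eta>" "\<And>\<theta>. \<theta> \<in> \<Theta> \<Longrightarrow> \<forall>p\<in>\<P>. \<bar>\<theta> p\<bar> \<le> R \<Longrightarrow>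
      0 < sqnorm (\<lambda>p. \<Psi> \<theta> p - \<theta> p) \<Longrightarrow> 0 \<le> t_star \<Psi> \<theta> \<and> t_star \<Psi> \<theta> \<le> 1 \<and>
        \<eta> * sqnorm (\<lambda>p. \<Psi> \<theta> p - \<theta> p) \<le> \<rho> \<Psi> \<theta> (t_star \<Psi> \<theta>)"
    using t_star_decrease[of R] by blast
  obtain C where C: "\<And>\<theta>. \<theta> \<in> \<Theta> \<Longrightarrow> \<forall>p\<in>\<P>. \<bar>\<theta> p\<bar> \<le> R \<Longrightarrow>
      f \<theta> - f theta_hat \<le> C * sqrt (sqnorm (\<lambda>p. \<Psi> \<theta> p - \<theta> p))"
    using optimality_gap[of R] by blast
  obtain c where c: "0 < c" "\<And>\<theta>. \<theta> \<in> \<Theta> \<Longrightarrow> \<forall>p\<in>\<P>. \<bar>\<theta> p\<bar> \<le> R \<Longrightarrow>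
      c * sqnorm (\<lambda>p. \<theta> p - theta_hat p) \<le> f \<theta> - f theta_hat"
    using strong_minimality[of R] by blast
  have "segment_point \<theta> (\<Psi> \<theta>) t \<in> \<Theta> \<and>
      \<eta> * sqnorm (\<lambda>p. \<Psi> \<theta> p - \<theta> p) \<le> f \<theta> - f (segment_point \<theta> (\<Psi> \<theta>) t)"
    if \<theta>: "\<theta> \<in> \<Theta>" "\<forall>p\<in>\<P>. \<bar>\<theta> p\<bar> \<le> R" and t: "t \<in> step_sizes \<Psi> \<theta>" for \<theta> t
  proof (cases "\<theta> = theta_hat")
    case True
    let ?\<delta> = "\<lambda>p. \<Psi> \<theta> p - \<theta> p"
    \<comment> \<open>At the minimizer, descent and optimality give opposite signs to the same
      derivative. The displacement is therefore zero, and an arbitrary step size leaves the point in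
      place.\<close>
    have "0 < N * exp (- R) / (1 + (real (card \<P>))\<^sup>2)"
      using n_obs_ge_1 by (intro divide_pos_pos add_pos_nonneg) auto
    moreover have "N * exp (- R) / (1 + (real (card \<P>))\<^sup>2) * sqnorm ?\<delta> \<le> - dir_deriv \<theta> ?\<delta>"
      using \<theta> by (intro descent_direction) auto
    moreover have "0 \<le> dir_deriv \<theta> ?\<delta>"
      using theta_hat_optimal[OF proposal_in_\<Theta>[of \<theta>]] by (simp add: True)
    ultimately have "sqnorm ?\<delta> \<le> 0" using mult_pos_pos[of _ "sqnorm ?\<delta>"] by (smt (verit))
    then have "sqnorm ?\<delta> = 0" using sqnorm_nonneg[of ?\<delta>] by simp
    then have "\<Psi> \<theta> = \<theta>" by (intro sqnorm_eq_0 proposal_in_\<Theta> \<theta>)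
    moreover have "segment_point \<theta> \<theta> t = \<theta>" by (auto simp: segment_point_def algebra_simps)
    ultimately show ?thesis using \<theta> by (simp add: sqnorm_def)
  next
    case False
    have ts: "t = t_star \<Psi> \<theta>" using t False by (simp add: step_sizes_def)
    \<comment> \<open>A zero displacement would close the optimality gap, and strong minimality
      would then force \<open>\<theta> = theta_hat\<close>.\<close>
    have "0 < sqnorm (\<lambda>p. \<Psi> \<theta> p - \<theta> p)"
    proof (rule ccontr)
      assume "\<not> ?thesis"
      then have "sqnorm (\<lambda>p. \<Psi> \<theta> p - \<theta> p) = 0" using sqnorm_nonneg[of "\<lambda>p. \<Psi> \<theta> p - \<theta> p"] by simp
      then have "c * sqnorm (\<lambda>p. \<theta> p - theta_hat p) \<le> 0" using C[OF \<theta>] c(2)[OF \<theta>] by simp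
      then have "sqnorm (\<lambda>p. \<theta> p - theta_hat p) = 0"
        using c(1) sqnorm_nonneg[of "\<lambda>p. \<theta> p - theta_hat p"] by (simp add: mult_le_0_iff)
      then show False using sqnorm_eq_0[OF \<theta>(1) theta_hat_minimizes(1)] False by simp
    qed
    from \<eta>(2)[OF \<theta> this] show ?thesis
      using segment_in_\<Theta>[OF \<theta>(1) proposal_in_\<Theta>] by (simp add: ts \<rho>_def)
  qed
  then show ?thesis using \<eta>(1) C by blast
qed

end

section \<open>The row and the column proposal, convergence\<close>

context lr_pos
begin

section \<open>Verification of the row and column constructions\<close>

lemma sum_single_row_le:
  assumes "j \<in> {1..l}" "A \<subseteq> {row_lo j..row_hi j}" "\<And>p. 0 \<le> g p"
  shows "(\<Sum>k\<in>A. g (j, k)) \<le> (\<Sum>p\<in>\<P>. g p :: real)"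
proof -
  have "(\<Sum>k\<in>A. g (j, k)) = sum g (Pair j ` A)" by (simp add: sum.reindex inj_on_def)
  also have "\<dots> \<le> sum g \<P>"
    using assms row_interval[OF assms(1)] by (intro sum_mono2) auto
  finally show ?thesis .
qed

lemma sum_single_col_le:
  assumes "k \<in> {1..m}" "A \<subseteq> {col_lo k..col_hi k}" "\<And>p. 0 \<le> g p"
  shows "(\<Sum>j\<in>A. g (j, k)) \<le> (\<Sum>p\<in>\<P>. g p :: real)"
proof -
  have "(\<Sum>j\<in>A. g (j, k)) = sum g ((\<lambda>j. (j, k)) ` A)" by (simp add: sum.reindex inj_on_def)
  also have "\<dots> \<le> sum g \<P>"
    using assms col_interval[OF assms(1)] by (intro sum_mono2) auto
  finally show ?thesis .
qed

text \<open>Since each row of \<open>\<P>\<close> is an interval, partial sums along the row invert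
  \<open>T_row\<close>, which gives the control of \<open>d\<close>, and summation by parts gives
  the gradient in the new coordinates.\<close>

lemma lr_proposal_row: "lr_proposal l m w T_row v_row W_row"
proof unfold_locales
  show "T_row (\<lambda>p. a * x p + b * y p) = (\<lambda>p. a * T_row x p + b * T_row y p)" for a b x y
    by (auto simp: T_row_def fun_eq_iff algebra_simps)
  show "continuous_on UNIV (\<lambda>d. T_row d p)" for p
    by (cases p; cases "p \<in> \<P>"; cases "snd p = row_lo (fst p)")
      (auto simp: T_row_def intro!: continuous_intros)
  have T: "T_row d (j, k) = (if k = row_lo j then d (j, k) else d (j, k) - d (j, k - 1))"
    if "(j, k) \<in> \<P>" for d j k
    using that by (simp add: T_row_def)
  show "\<bar>d p\<bar> \<le> (\<Sum>q\<in>\<P>. \<bar>T_row d q\<bar>)" if "p \<in> \<P>" for p d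
  proof -
    obtain j k where p: "p = (j, k)" by (cases p)
    have jl: "j \<in> {1..l}" and k: "row_lo j \<le> k" "k \<le> row_hi j"
      using that p \<P>_range row_interval by blast+
    have "d p = (\<Sum>i=row_lo j..k. if i = row_lo j then d (j, i) else d (j, i) - d (j, i - 1))"
      using telescope_interval[OF k(1), of "\<lambda>i. d (j, i)"] by (simp add: p)
    also have "\<dots> = (\<Sum>i=row_lo j..k. T_row d (j, i))"
      using k row_interval[OF jl] by (intro sum.cong refl) (auto simp: T)
    finally have "\<bar>d p\<bar> \<le> (\<Sum>i=row_lo j..k. \<bar>T_row d (j, i)\<bar>)" by simp
    also have "\<dots> \<le> (\<Sum>q\<in>\<P>. \<bar>T_row d q\<bar>)"
      using k by (intro sum_single_row_le[OF jl, of _ "\<lambda>q. \<bar>T_row d q\<bar>"]) auto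
    finally show ?thesis .
  qed
  show "\<bar>T_row d p\<bar> \<le> 2 * B" if B: "\<And>q. q \<in> \<P> \<Longrightarrow> \<bar>d q\<bar> \<le> B" and p: "p \<in> \<P>" for d B p
  proof -
    obtain j k where jk: "p = (j, k)" by (cases p)
    have jl: "j \<in> {1..l}" and k: "row_lo j \<le> k" "k \<le> row_hi j"
      using p jk \<P>_range row_interval by blast+
    have 1: "\<bar>d (j, k)\<bar> \<le> B" using B p jk by simp
    then have B0: "0 \<le> B" by linarith
    have Tp: "T_row d p = (if k = row_lo j then d (j, k) else d (j, k) - d (j, k - 1))"
      unfolding jk using p jk by (intro T) simp
    show ?thesis
    proof (cases "k = row_lo j")
      case True
      then have "T_row d p = d (j, k)" unfolding Tp by (rule if_P)
      then show ?thesis using 1 B0 by linarith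
    next
      case False
      then have "T_row d p = d (j, k) - d (j, k - 1)" unfolding Tp by (rule if_not_P)
      \<comment> \<open>A column \<open>k\<close> other than \<open>row_lo j\<close> is strictly
        larger, so the left neighbour is still in the row interval.\<close>
      moreover have "(j, k - 1) \<in> \<P>" unfolding row_interval[OF jl] using k False by linarith
      then have "\<bar>d (j, k - 1)\<bar> \<le> B" by (rule B)
      ultimately show ?thesis using 1 by linarith
    qed
  qed
  show "dir_deriv \<theta> d = (\<Sum>p\<in>\<P>. (v_row \<theta> p - W_row p) * T_row d p)" for \<theta> d
    unfolding dir_deriv_def sum_\<P>_rows
  proof (rule sum.cong[OF refl])
    fix j assume jl: "j \<in> {1..l}"
    let ?u = "\<lambda>k. N * exp (\<theta> (j, k)) - real (w j k)"
    have "(\<Sum>k=row_lo j..row_hi j. ?u k * d (j, k)) = (\<Sum>k=row_lo j..row_hi j.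
        (\<Sum>k'=k..row_hi j. ?u k') * (if k = row_lo j then d (j, k) else d (j, k) - d (j, k - 1)))"
      by (rule summation_by_parts)
    \<comment> \<open>The tail sums of the gradient entries are exactly
      \<open>v_row - W_row\<close>.\<close>
    also have "\<dots> = (\<Sum>k=row_lo j..row_hi j. (v_row \<theta> (j, k) - W_row (j, k)) * T_row d (j, k))"
      using row_interval[OF jl]
      by (intro sum.cong refl) (simp add: T v_row_def W_row_def sum_subtractf sum_distrib_left)
    finally show "(\<Sum>k=row_lo j..row_hi j. (N * exp (\<theta> (j, k)) - weight (j, k)) * d (j, k)) =
        (\<Sum>k=row_lo j..row_hi j. (v_row \<theta> (j, k) - W_row (j, k)) * T_row d (j, k))" by simp
  qed
  show "N * exp (\<theta> p) \<le> v_row \<theta> p" if "p \<in> \<P>" for \<theta> p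
  proof -
    obtain j k where p: "p = (j, k)" by (cases p)
    have "k \<le> row_hi j" using that p \<P>_range row_interval by blast
    then have "exp (\<theta> (j, k)) \<le> (\<Sum>k'=k..row_hi j. exp (\<theta> (j, k')))"
      by (intro member_le_sum[of k _ "\<lambda>k. exp (\<theta> (j, k))"]) auto
    then show ?thesis by (simp add: p v_row_def mult_left_mono)
  qed
  show "v_row \<theta> p \<le> N * (real (card \<P>) * B)"
    if B: "\<And>q. q \<in> \<P> \<Longrightarrow> exp (\<theta> q) \<le> B" and "p \<in> \<P>" for \<theta> B p
  proof -
    obtain j k where p: "p = (j, k)" by (cases p)
    have jl: "j \<in> {1..l}" and k: "row_lo j \<le> k"
      using that p \<P>_range row_interval by blast+
    have "(\<Sum>k'=k..row_hi j. exp (\<theta> (j, k'))) \<le> (\<Sum>q\<in>\<P>. exp (\<theta> q))"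
      using k by (intro sum_single_row_le[OF jl, of _ "\<lambda>q. exp (\<theta> q)"]) auto
    also have "\<dots> \<le> real (card \<P>) * B" using B by (intro sum_bounded_above)
    finally show ?thesis by (simp add: p v_row_def mult_left_mono)
  qed
qed

text \<open>The row argument carried out along columns, which are intervals by
  \<open>col_interval\<close>.\<close>

lemma lr_proposal_col: "lr_proposal l m w T_col v_col W_col"
proof unfold_locales
  show "T_col (\<lambda>p. a * x p + b * y p) = (\<lambda>p. a * T_col x p + b * T_col y p)" for a b x y
    by (auto simp: T_col_def fun_eq_iff algebra_simps)
  show "continuous_on UNIV (\<lambda>d. T_col d p)" for p
    by (cases p; cases "p \<in> \<P>"; cases "fst p = col_lo (snd p)")
      (auto simp: T_col_def intro!: continuous_intros)
  have T: "T_col d (j, k) = (if j = col_lo k then d (j, k) else d (j, k) - d (j - 1, k))"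
    if "(j, k) \<in> \<P>" for d j k
    using that by (simp add: T_col_def)
  show "\<bar>d p\<bar> \<le> (\<Sum>q\<in>\<P>. \<bar>T_col d q\<bar>)" if "p \<in> \<P>" for p d
  proof -
    obtain j k where p: "p = (j, k)" by (cases p)
    have km: "k \<in> {1..m}" and j: "col_lo k \<le> j" "j \<le> col_hi k"
      using that p \<P>_range col_interval by blast+
    have "d p = (\<Sum>i=col_lo k..j. if i = col_lo k then d (i, k) else d (i, k) - d (i - 1, k))"
      using telescope_interval[OF j(1), of "\<lambda>i. d (i, k)"] by (simp add: p)
    also have "\<dots> = (\<Sum>i=col_lo k..j. T_col d (i, k))"
      using j col_interval[OF km] by (intro sum.cong refl) (auto simp: T)
    finally have "\<bar>d p\<bar> \<le> (\<Sum>i=col_lo k..j. \<bar>T_col d (i, k)\<bar>)" by simp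
    also have "\<dots> \<le> (\<Sum>q\<in>\<P>. \<bar>T_col d q\<bar>)"
      using j by (intro sum_single_col_le[OF km, of _ "\<lambda>q. \<bar>T_col d q\<bar>"]) auto
    finally show ?thesis .
  qed
  show "\<bar>T_col d p\<bar> \<le> 2 * B" if B: "\<And>q. q \<in> \<P> \<Longrightarrow> \<bar>d q\<bar> \<le> B" and p: "p \<in> \<P>" for d B p
  proof -
    obtain j k where jk: "p = (j, k)" by (cases p)
    have km: "k \<in> {1..m}" and j: "col_lo k \<le> j" "j \<le> col_hi k"
      using p jk \<P>_range col_interval by blast+
    have 1: "\<bar>d (j, k)\<bar> \<le> B" using B p jk by simp
    then have B0: "0 \<le> B" by linarith
    have Tp: "T_col d p = (if j = col_lo k then d (j, k) else d (j, k) - d (j - 1, k))"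
      unfolding jk using p jk by (intro T) simp
    show ?thesis
    proof (cases "j = col_lo k")
      case True
      then have "T_col d p = d (j, k)" unfolding Tp by (rule if_P)
      then show ?thesis using 1 B0 by linarith
    next
      case False
      then have "T_col d p = d (j, k) - d (j - 1, k)" unfolding Tp by (rule if_not_P)
      moreover have "(j - 1, k) \<in> \<P>" unfolding col_interval[OF km] using j False by linarith
      then have "\<bar>d (j - 1, k)\<bar> \<le> B" by (rule B)
      ultimately show ?thesis using 1 by linarith
    qed
  qed
  show "dir_deriv \<theta> d = (\<Sum>p\<in>\<P>. (v_col \<theta> p - W_col p) * T_col d p)" for \<theta> d
    unfolding dir_deriv_def sum_\<P>_cols
  proof (rule sum.cong[OF refl])
    fix k assume km: "k \<in> {1..m}"
    let ?u = "\<lambda>j. N * exp (\<theta> (j, k)) - real (w j k)"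
    have "(\<Sum>j=col_lo k..col_hi k. ?u j * d (j, k)) = (\<Sum>j=col_lo k..col_hi k.
        (\<Sum>j'=j..col_hi k. ?u j') * (if j = col_lo k then d (j, k) else d (j, k) - d (j - 1, k)))"
      by (rule summation_by_parts)
    also have "\<dots> = (\<Sum>j=col_lo k..col_hi k. (v_col \<theta> (j, k) - W_col (j, k)) * T_col d (j, k))"
      using col_interval[OF km]
      by (intro sum.cong refl) (simp add: T v_col_def W_col_def sum_subtractf sum_distrib_left)
    finally show "(\<Sum>j=col_lo k..col_hi k. (N * exp (\<theta> (j, k)) - weight (j, k)) * d (j, k)) =
        (\<Sum>j=col_lo k..col_hi k. (v_col \<theta> (j, k) - W_col (j, k)) * T_col d (j, k))" by simp
  qed
  show "N * exp (\<theta> p) \<le> v_col \<theta> p" if "p \<in> \<P>" for \<theta> p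
  proof -
    obtain j k where p: "p = (j, k)" by (cases p)
    have "j \<le> col_hi k" using that p \<P>_range col_interval by blast
    then have "exp (\<theta> (j, k)) \<le> (\<Sum>j'=j..col_hi k. exp (\<theta> (j', k)))"
      by (intro member_le_sum[of j _ "\<lambda>j. exp (\<theta> (j, k))"]) auto
    then show ?thesis by (simp add: p v_col_def mult_left_mono)
  qed
  show "v_col \<theta> p \<le> N * (real (card \<P>) * B)"
    if B: "\<And>q. q \<in> \<P> \<Longrightarrow> exp (\<theta> q) \<le> B" and "p \<in> \<P>" for \<theta> B p
  proof -
    obtain j k where p: "p = (j, k)" by (cases p)
    have km: "k \<in> {1..m}" and j: "col_lo k \<le> j"
      using that p \<P>_range col_interval by blast+
    have "(\<Sum>j'=j..col_hi k. exp (\<theta> (j', k))) \<le> (\<Sum>q\<in>\<P>. exp (\<theta> q))"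
      using j by (intro sum_single_col_le[OF km, of _ "\<lambda>q. exp (\<theta> q)"]) auto
    also have "\<dots> \<le> real (card \<P>) * B" using B by (intro sum_bounded_above)
    finally show ?thesis by (simp add: p v_col_def mult_left_mono)
  qed
qed

section \<open>Convergence of the iteration\<close>

lemma iteration_converges:
  fixes \<theta> :: "nat \<Rightarrow> vec" and \<Psi> :: "nat \<Rightarrow> vec \<Rightarrow> vec" and t :: "nat \<Rightarrow> real"
  assumes init: "\<theta> 0 \<in> \<Theta>" and \<Psi>: "\<And>s. \<Psi> s \<in> {Psi_row, Psi_col}"
    and t: "\<And>s. t s \<in> step_sizes (\<Psi> s) (\<theta> s)"
    and step: "\<And>s. \<theta> (Suc s) = segment_point (\<theta> s) (\<Psi> s (\<theta> s)) (t s)"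
  shows "\<theta> \<longlonglongrightarrow> theta_hat"
proof -
  define R where "R = 5 * (1 + 4 * f (\<theta> 0))"
  define Q where "Q s = sqnorm (\<lambda>p. \<Psi> s (\<theta> s) p - \<theta> s p)" for s
  obtain \<eta>1 C1 where row: "0 < \<eta>1" "\<forall>\<theta>\<in>\<Theta>. (\<forall>p\<in>\<P>. \<bar>\<theta> p\<bar> \<le> R) \<longrightarrow>
      (\<forall>t\<in>step_sizes Psi_row \<theta>. segment_point \<theta> (Psi_row \<theta>) t \<in> \<Theta> \<and>
        \<eta>1 * sqnorm (\<lambda>p. Psi_row \<theta> p - \<theta> p) \<le> f \<theta> - f (segment_point \<theta> (Psi_row \<theta>) t)) \<and>
      f \<theta> - f theta_hat \<le> C1 * sqrt (sqnorm (\<lambda>p. Psi_row \<theta> p - \<theta> p))"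
    using lr_proposal.step_estimates[OF lr_proposal_row, of R] unfolding Psi_row_def by blast
  obtain \<eta>2 C2 where col: "0 < \<eta>2" "\<forall>\<theta>\<in>\<Theta>. (\<forall>p\<in>\<P>. \<bar>\<theta> p\<bar> \<le> R) \<longrightarrow>
      (\<forall>t\<in>step_sizes Psi_col \<theta>. segment_point \<theta> (Psi_col \<theta>) t \<in> \<Theta> \<and>
        \<eta>2 * sqnorm (\<lambda>p. Psi_col \<theta> p - \<theta> p) \<le> f \<theta> - f (segment_point \<theta> (Psi_col \<theta>) t)) \<and>
      f \<theta> - f theta_hat \<le> C2 * sqrt (sqnorm (\<lambda>p. Psi_col \<theta> p - \<theta> p))"
    using lr_proposal.step_estimates[OF lr_proposal_col, of R] unfolding Psi_col_def by blast
  obtain c where c: "0 < c" "\<And>\<theta>. \<theta> \<in> \<Theta> \<Longrightarrow> \<forall>p\<in>\<P>. \<bar>\<theta> p\<bar> \<le> R \<Longrightarrow>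
      c * sqnorm (\<lambda>p. \<theta> p - theta_hat p) \<le> f \<theta> - f theta_hat"
    using strong_minimality[of R] by blast
  \<comment> \<open>The worse constants of the two proposals make the estimates independent of the
    choice made at each step.\<close>
  define \<eta> where "\<eta> = min \<eta>1 \<eta>2"
  define C where "C = max C1 C2"
  have \<eta>: "0 < \<eta>" using row(1) col(1) by (simp add: \<eta>_def)
  have Q0: "0 \<le> Q s" for s by (simp add: Q_def sqnorm_nonneg)
  have est: "\<theta> (Suc s) \<in> \<Theta>" "\<eta> * Q s \<le> f (\<theta> s) - f (\<theta> (Suc s))"
    "f (\<theta> s) - f theta_hat \<le> C * sqrt (Q s)"
    if s: "\<theta> s \<in> \<Theta>" "\<forall>p\<in>\<P>. \<bar>\<theta> s p\<bar> \<le> R" for s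
  proof -
    have le: "\<eta> * Q s \<le> \<eta>1 * Q s" "\<eta> * Q s \<le> \<eta>2 * Q s"
      "C1 * sqrt (Q s) \<le> C * sqrt (Q s)" "C2 * sqrt (Q s) \<le> C * sqrt (Q s)"
      using Q0[of s] by (auto intro!: mult_right_mono simp: \<eta>_def C_def)
    consider "\<Psi> s = Psi_row" | "\<Psi> s = Psi_col" using \<Psi>[of s] by blast
    then have "\<theta> (Suc s) \<in> \<Theta> \<and> \<eta> * Q s \<le> f (\<theta> s) - f (\<theta> (Suc s)) \<and>
        f (\<theta> s) - f theta_hat \<le> C * sqrt (Q s)"
    proof cases
      case 1
      with t[of s] have "t s \<in> step_sizes Psi_row (\<theta> s)" by simp
      from row(2)[rule_format, OF s(1) s(2)[rule_format]] this
      show ?thesis using le by (auto simp: step 1 Q_def intro: order_trans)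
    next
      case 2
      with t[of s] have "t s \<in> step_sizes Psi_col (\<theta> s)" by simp
      from col(2)[rule_format, OF s(1) s(2)[rule_format]] this
      show ?thesis using le by (auto simp: step 2 Q_def intro: order_trans)
    qed
    then show "\<theta> (Suc s) \<in> \<Theta>" "\<eta> * Q s \<le> f (\<theta> s) - f (\<theta> (Suc s))"
      "f (\<theta> s) - f theta_hat \<le> C * sqrt (Q s)" by blast+
  qed
  have bounded: "\<forall>p\<in>\<P>. \<bar>\<theta> s p\<bar> \<le> R" if "\<theta> s \<in> \<Theta>" "f (\<theta> s) \<le> f (\<theta> 0)" for s
    unfolding R_def using sublevel_bounded[OF that] by blast
  \<comment> \<open>The decrease needs the bound \<open>R\<close>, and the bound needs the iterates
    to stay in the initial sublevel set; one induction delivers both.\<close>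
  have inv: "\<theta> s \<in> \<Theta> \<and> f (\<theta> s) \<le> f (\<theta> 0)" for s
  proof (induction s)
    case (Suc s)
    then have "\<theta> (Suc s) \<in> \<Theta>" "\<eta> * Q s \<le> f (\<theta> s) - f (\<theta> (Suc s))"
      using est bounded by blast+
    moreover have "0 \<le> \<eta> * Q s" using \<eta> Q0 by simp
    ultimately show ?case using Suc by linarith
  qed (simp add: init)
  note est = est[OF conjunct1[OF inv] bounded[OF conjunct1[OF inv] conjunct2[OF inv]]]
  have "decseq (\<lambda>s. f (\<theta> s))"
  proof (rule decseq_SucI)
    fix s
    have "0 \<le> \<eta> * Q s" using \<eta> Q0 by simp
    then show "f (\<theta> (Suc s)) \<le> f (\<theta> s)" using est(2)[of s] by linarith
  qed
  then obtain L where L: "(\<lambda>s. f (\<theta> s)) \<longlonglongrightarrow> L"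
    using decseq_convergent[of "\<lambda>s. f (\<theta> s)" 0] f_nonneg by blast
  have "(\<lambda>s. f (\<theta> s) - f (\<theta> (Suc s))) \<longlonglongrightarrow> L - L"
    by (intro tendsto_diff L LIMSEQ_Suc)
  then have d0: "(\<lambda>s. (f (\<theta> s) - f (\<theta> (Suc s))) / \<eta>) \<longlonglongrightarrow> 0"
    by (intro tendsto_divide_zero) simp
  \<comment> \<open>The values of \<open>f\<close> decrease and are bounded below, so their
    successive differences vanish, and these dominate \<open>\<eta> * Q s\<close>.\<close>
  have "Q \<longlonglongrightarrow> 0"
  proof (rule tendsto_sandwich[OF _ _ tendsto_const d0])
    show "\<forall>\<^sub>F s in sequentially. Q s \<le> (f (\<theta> s) - f (\<theta> (Suc s))) / \<eta>"
      using est(2) \<eta> by (simp add: pos_le_divide_eq mult.commute)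
  qed (simp add: Q0)
  then have "(\<lambda>s. C * sqrt (Q s) / c) \<longlonglongrightarrow> C * sqrt 0 / c"
    using c(1) by (intro tendsto_intros) auto
  then have q0: "(\<lambda>s. sqrt (C * sqrt (Q s) / c)) \<longlonglongrightarrow> 0"
    using tendsto_real_sqrt by fastforce
  show ?thesis
  proof (rule tendsto_coordinatewise)
    fix p
    show "(\<lambda>s. \<theta> s p) \<longlonglongrightarrow> theta_hat p"
    proof (cases "p \<in> \<P>")
      case True
      \<comment> \<open>Strong minimality bounds the squared distance by the gap over
        \<open>c\<close>, and the gap is at most \<open>C * sqrt (Q s)\<close>.\<close>
      have "\<bar>\<theta> s p - theta_hat p\<bar> \<le> sqrt (C * sqrt (Q s) / c)" for s
      proof -
        have "(\<theta> s p - theta_hat p)\<^sup>2 \<le> sqnorm (\<lambda>p. \<theta> s p - theta_hat p)"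
          unfolding sqnorm_def using True
          by (intro member_le_sum[of p \<P> "\<lambda>p. (\<theta> s p - theta_hat p)\<^sup>2"]) auto
        also have "\<dots> \<le> C * sqrt (Q s) / c"
          using c(2)[of "\<theta> s"] inv[of s] bounded[of s] est(3)[of s] c(1)
          by (simp add: pos_le_divide_eq mult.commute)
        finally show ?thesis using real_le_rsqrt[of "\<bar>\<theta> s p - theta_hat p\<bar>"] by simp
      qed
      then have "(\<lambda>s. \<theta> s p - theta_hat p) \<longlonglongrightarrow> 0"
        by (intro Lim_null_comparison[OF _ q0]) simp
      then show ?thesis by (rule LIM_zero_cancel)
    next
      case False
      then have "\<theta> s p = 0" for s using \<Theta>_vecs[of "\<theta> s" p] inv[of s] by simp
      moreover have "theta_hat p = 0"
        using False \<Theta>_vecs[of theta_hat p] theta_hat_minimizes(1) by simp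
      ultimately show ?thesis by simp
    qed
  qed
qed

end

theorem theorem3p4:
  fixes l m :: nat and w :: "nat \<Rightarrow> nat \<Rightarrow> nat"
    and \<theta> :: "nat \<Rightarrow> vec" and \<Psi> :: "nat \<Rightarrow> vec \<Rightarrow> vec" and t :: "nat \<Rightarrow> real"
  assumes "l \<ge> 1" and "m \<ge> 1"
    and "\<And>j. j \<in> {1..l} \<Longrightarrow> (\<Sum>k=1..m. w j k) > 0"
    and "\<And>k. k \<in> {1..m} \<Longrightarrow> (\<Sum>j=1..l. w j k) > 0"
    and "\<theta> 0 \<in> lr_weights.\<Theta> l m w"
    and "\<And>s. \<Psi> s \<in> {lr_weights.Psi_row l m w, lr_weights.Psi_col l m w}"
    and "\<And>s. t s \<in> lr_weights.step_sizes l m w (\<Psi> s) (\<theta> s)"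
    and "\<And>s. \<theta> (Suc s) = segment_point (\<theta> s) (\<Psi> s (\<theta> s)) (t s)"
  shows "\<theta> \<longlonglongrightarrow> lr_weights.theta_hat l m w"
proof -
  interpret lr_pos l m w using assms(1,3,4) by unfold_locales
  show ?thesis using iteration_converges assms(5-8) .
qed

end
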